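(* The functional $\widehat{\mathcal{J}}:L^\infty((0,1);[0,1])\to\mathbb{R}$ attains its minimum.
   Context: Let $0<a<b$ and $c_l>0$ be constants. Let $W^{1,2}_l(0,1)=\{K\in W^{1,2}(0,1):K(0)=0\}$. For $B\in L^\infty((0,1);[a,b])$ let $K[B]\in W^{1,2}_l(0,1)$ be the unique global minimiser over $W^{1,2}_l(0,1)$ of $$K\mapsto\frac12\int_0^1B(t)(K'(t))^2\,dt+\int_0^1(1-t)\sin K(t)\,dt$$ (existence and uniqueness of this minimiser are known). It solves the state equation $(BK[B]')'=(1-t)\cos K[B]$ in the dual space of $W^{1,2}_l(0,1)$ (which encodes $K[B](0)=0$ and the natural condition $K[B]'(1)=0$) and takes values in $(-\pi/2,0]$. For $\theta\in L^\infty((0,1);[0,1])$ set $B_\theta=(1-\theta)a+\theta b$. For $K\in W^{1,2}_l(0,1)$ and $\theta\in L^\infty(0,1)$ set $$\mathcal{J}[K,\theta]=-\int_0^1(1-t)\sin K(t)\,dt+c_l\int_0^1\theta(t)\,dt,$$ and define $\widehat{\mathcal{J}}[\theta]=\mathcal{J}[K[B_\theta],\theta]$ for $\theta\in L^\infty((0,1);[0,1])$. *)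

theory Defs
  imports "HOL-Analysis.Analysis"
begin

abbreviation unit_interval :: "real measure" where
  "unit_interval \<equiv> lebesgue_on {0<..<1}"

definition L2 :: "(real \<Rightarrow> real) set" where
  "L2 = {f \<in> borel_measurable unit_interval. integrable unit_interval (\<lambda>t. (f t)\<^sup>2)}"

text \<open>\<open>Linf_into A\<close> is $L^\infty((0,1);A)$ for a bounded set \<open>A\<close>. Its elements are functions, not
  classes modulo null sets; everything below depends on them only up to null sets.\<close>

definition Linf_into :: "real set \<Rightarrow> (real \<Rightarrow> real) set" where
  "Linf_into A = {f \<in> borel_measurable unit_interval. AE t in unit_interval. f t \<in> A}"

text \<open>$C^1_c(0,1)$, extended by zero to the real line.\<close>

definition test_functions :: "(real \<Rightarrow> real) set" where
  "test_functions = {\<phi>. \<phi> C1_differentiable_on UNIV \<and>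
     compact (closure {t. \<phi> t \<noteq> 0}) \<and> closure {t. \<phi> t \<noteq> 0} \<subseteq> {0<..<1}}"

definition is_weak_deriv :: "(real \<Rightarrow> real) \<Rightarrow> (real \<Rightarrow> real) \<Rightarrow> bool" where
  "is_weak_deriv K g \<longleftrightarrow> (\<forall>\<phi>\<in>test_functions.
     (LINT t|unit_interval. K t * deriv \<phi> t) = - (LINT t|unit_interval. g t * \<phi> t))"

text \<open>Each class in $W^{1,2}(0,1)$ is represented by its continuous representative on $[0,1]$, so that
  point values make sense; extensionality fixes the irrelevant values outside $[0,1]$, so that
  equality of elements of \<open>W12\<close> is equality in $W^{1,2}(0,1)$.\<close>

definition W12 :: "(real \<Rightarrow> real) set" where
  "W12 = {K \<in> L2. K \<in> extensional {0..1} \<and> continuous_on {0..1} K \<and>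
     (\<exists>g\<in>L2. is_weak_deriv K g)}"

definition W12_l :: "(real \<Rightarrow> real) set" where
  "W12_l = {K \<in> W12. K 0 = 0}"

text \<open>Determined only up to null sets.\<close>

definition weak_deriv :: "(real \<Rightarrow> real) \<Rightarrow> real \<Rightarrow> real" where
  "weak_deriv K = (SOME g. g \<in> L2 \<and> is_weak_deriv K g)"

definition energy :: "(real \<Rightarrow> real) \<Rightarrow> (real \<Rightarrow> real) \<Rightarrow> real" where
  "energy B K = 1/2 * (LINT t|unit_interval. B t * (weak_deriv K t)\<^sup>2)
     + (LINT t|unit_interval. (1 - t) * sin (K t))"

definition state :: "(real \<Rightarrow> real) \<Rightarrow> real \<Rightarrow> real" where
  "state B = (THE K. is_arg_min (energy B) (\<lambda>K. K \<in> W12_l) K)"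

definition stiffness :: "real \<Rightarrow> real \<Rightarrow> (real \<Rightarrow> real) \<Rightarrow> real \<Rightarrow> real" where
  "stiffness a b \<theta> t = (1 - \<theta> t) * a + \<theta> t * b"

definition cost :: "real \<Rightarrow> (real \<Rightarrow> real) \<Rightarrow> (real \<Rightarrow> real) \<Rightarrow> real" where
  "cost c_l K \<theta> = - (LINT t|unit_interval. (1 - t) * sin (K t)) + c_l * (LINT t|unit_interval. \<theta> t)"

definition reduced_cost :: "real \<Rightarrow> real \<Rightarrow> real \<Rightarrow> (real \<Rightarrow> real) \<Rightarrow> real" where
  "reduced_cost a b c_l \<theta> = cost c_l (state (stiffness a b \<theta>)) \<theta>"

end

theory Submission
  imports Defs "HOL-Complex_Analysis.Great_Picard"
begin

text \<open>
  Write $\sigma = 1/B$ and $P[K](t) = \int_t^1 (1-s)\cos K(s)\,ds$. A function with values in $[-\pi/2,0]$ is the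
  unique global minimiser of the energy as soon as $K(t) = -\int_0^t \sigma\,P[K]$, because the sine is
  convex on $[-\pi,0]$. Such a solution exists: minimise a modified energy over the $K = -\int\sigma p$
  with $p$ in a compact convex set of Lipschitz functions, and vary $p$ in the direction of $P[K]$.

  Along a minimising sequence of volume fractions the states converge uniformly to some $K$ by
  Arzela-Ascoli. The coefficients $\sigma$ that nearly satisfy $K = -\int\sigma\,P[K]$ and whose volume
  $\int 1/\sigma$ is nearly optimal form decreasing convex sets, since the first condition is affine and
  $x \mapsto 1/x$ is convex. Their elements of almost least norm converge almost everywhere, and the limit
  has state $K$ and no larger volume, so it is optimal.
\<close>

section \<open>Primitives on the unit interval\<close>

text \<open>The state depends on the volume fraction through 1/B, and 1/B does not follow the weak
  limit of B when the fractions oscillate. Hence the limit is taken in \<sigma>. With the limit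
  state K inserted in the cosine, the state equation becomes linear in \<sigma>. The volume is
  convex in \<sigma>, so averaging does not increase it, and c_l > 0 turns this into a bound for the
  cost.

  \<open>state\<close> is a definite description, so it says nothing until existence and uniqueness
  of the minimiser are proved. For existence the unknown is p = -B K' and not K': B is only
  measurable, but p is the primitive of a bounded function. It therefore ranges over functions with
  a common Lipschitz constant, which are compact for uniform convergence, and no weak lower
  semicontinuity is involved. The sine is modified below -pi/2 so that p stays nonnegative.\<close>

definition prim :: "(real \<Rightarrow> real) \<Rightarrow> real \<Rightarrow> real" where
  "prim g t = (LINT s|unit_interval. indicator {..t} s * g s)"

text \<open>For t in [0,1] and integrable f this is int_t^1 f (\<open>tail_eq\<close>), and it is
  the adjoint of \<open>prim\<close> (\<open>prim_Fubini\<close>). As a difference it inherits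
  continuity and Lipschitz bounds from \<open>prim\<close>.\<close>

definition tail :: "(real \<Rightarrow> real) \<Rightarrow> real \<Rightarrow> real" where
  "tail f t = (LINT s|unit_interval. f s) - prim f t"

lemma finite_measure_unit_interval: "finite_measure unit_interval"
  by (rule finite_measureI) (simp add: emeasure_restrict_space)

interpretation unit_interval: finite_measure unit_interval
  by (rule finite_measure_unit_interval)

lemma measure_unit_interval: "measure unit_interval {0<..<1} = 1"
  by (simp add: measure_restrict_space)

lemma borel_imp_measurable_unit_interval:
  fixes f :: "real \<Rightarrow> real"
  assumes "f \<in> borel_measurable borel"
  shows "f \<in> borel_measurable unit_interval"
proof -
  have "f \<in> borel_measurable lborel" using assms by simp
  from measurable_restrict_space1[OF measurable_completion[OF this]] show ?thesis .
qed

lemma indicator_measurable_unit_interval [measurable]: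
  fixes A :: "real set"
  assumes "A \<in> sets borel"
  shows "(indicator A :: real \<Rightarrow> real) \<in> borel_measurable unit_interval"
  by (rule borel_imp_measurable_unit_interval) (use assms in simp)

lemma AE_unit_interval_neq: "AE t in unit_interval. t \<noteq> c"
proof -
  have "AE t in lebesgue. t \<noteq> c"
    by (rule AE_completion) (rule AE_lborel_singleton)
  then have "AE t in lebesgue. t \<in> {0<..<1} \<longrightarrow> t \<noteq> c"
    by eventually_elim simp
  then show ?thesis by (subst AE_restrict_space_iff) auto
qed

lemma continuous_on_imp_measurable_unit_interval:
  fixes f :: "real \<Rightarrow> real"
  assumes "continuous_on {0..1} f"
  shows "f \<in> borel_measurable unit_interval"
  by (rule continuous_imp_measurable_on_sets_lebesgue)
     (use assms in \<open>auto intro: continuous_on_subset\<close>)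

lemma integrable_unit_interval_bounded:
  fixes f :: "real \<Rightarrow> real"
  assumes "f \<in> borel_measurable unit_interval" "\<And>t. 0 < t \<Longrightarrow> t < 1 \<Longrightarrow> \<bar>f t\<bar> \<le> C"
  shows "integrable unit_interval f"
  by (rule unit_interval.integrable_const_bound[where B = C]) (use assms in auto)

lemma integrable_unit_interval_continuous:
  fixes f :: "real \<Rightarrow> real"
  assumes "continuous_on {0..1} f"
  shows "integrable unit_interval f"
proof -
  have "bounded (f ` {0..1})" using assms by (intro compact_imp_bounded compact_continuous_image) auto
  then obtain C where C: "\<And>x. x \<in> {0..1} \<Longrightarrow> \<bar>f x\<bar> \<le> C"
    unfolding bounded_iff real_norm_def by blast
  show ?thesis
    by (rule integrable_unit_interval_bounded[OF continuous_on_imp_measurable_unit_interval[OF assms], of C])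
       (rule C, simp)
qed

lemma integrable_mult_bounded:
  fixes f g :: "real \<Rightarrow> real"
  assumes "integrable unit_interval g" "f \<in> borel_measurable unit_interval"
    and "\<And>t. 0 < t \<Longrightarrow> t < 1 \<Longrightarrow> \<bar>f t\<bar> \<le> C"
  shows "integrable unit_interval (\<lambda>t. f t * g t)"
proof (rule Bochner_Integration.integrable_bound)
  show "integrable unit_interval (\<lambda>t. C * g t)" using assms by auto
  show "(\<lambda>t. f t * g t) \<in> borel_measurable unit_interval" using assms by auto
  have "\<bar>f t\<bar> \<le> \<bar>C\<bar>" if "0 < t" "t < 1" for t using assms(3)[OF that] by auto
  then show "AE t in unit_interval. norm (f t * g t) \<le> norm (C * g t)"
    by (auto simp: abs_mult intro!: AE_I2 mult_right_mono)
qed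

lemma integrable_indicator_mult:
  assumes "integrable unit_interval g"
  shows "integrable unit_interval (\<lambda>s. indicator {..t::real} s * g s :: real)"
  by (rule integrable_mult_bounded[where C = 1, OF assms]) auto

lemma LINT_abs_le_const:
  fixes f :: "real \<Rightarrow> real"
  assumes "f \<in> borel_measurable unit_interval" "\<And>t. 0 < t \<Longrightarrow> t < 1 \<Longrightarrow> \<bar>f t\<bar> \<le> C"
  shows "\<bar>LINT t|unit_interval. f t\<bar> \<le> C"
proof -
  have "\<bar>LINT t|unit_interval. f t\<bar> \<le> (LINT t|unit_interval. \<bar>f t\<bar>)"
    by (rule integral_abs_bound)
  also have "\<dots> \<le> (LINT t|unit_interval. C)"
    by (rule integral_mono) (use assms in \<open>auto intro!: integrable_abs integrable_unit_interval_bounded\<close>)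
  finally show ?thesis by (simp add: measure_unit_interval)
qed

lemma prim_add:
  assumes "integrable unit_interval f" "integrable unit_interval g"
  shows "prim (\<lambda>s. f s + g s) t = prim f t + prim g t"
  using assms[THEN integrable_indicator_mult] by (simp add: prim_def distrib_left)

lemma prim_diff:
  assumes "integrable unit_interval f" "integrable unit_interval g"
  shows "prim (\<lambda>s. f s - g s) t = prim f t - prim g t"
  using assms[THEN integrable_indicator_mult] by (simp add: prim_def right_diff_distrib)

lemma prim_cmult: "prim (\<lambda>s. c * g s) t = c * prim g t"
  unfolding prim_def by (subst integral_mult_right_zero[symmetric]) (simp add: mult.left_commute)

lemma prim_minus: "prim (\<lambda>s. - g s) t = - prim g t"
  using prim_cmult[of "-1"] by simp

lemma prim_cong_AE:
  assumes "AE s in unit_interval. f s = g s"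
    "f \<in> borel_measurable unit_interval" "g \<in> borel_measurable unit_interval"
  shows "prim f t = prim g t"
  unfolding prim_def by (rule integral_cong_AE) (use assms in \<open>auto intro!: borel_measurable_times\<close>)

lemma prim_nonneg:
  assumes "\<And>s. 0 < s \<Longrightarrow> s < 1 \<Longrightarrow> 0 \<le> g s"
  shows "0 \<le> prim g t"
  unfolding prim_def by (rule Bochner_Integration.integral_nonneg) (use assms in auto)

lemma abs_prim_le: "\<bar>prim g t\<bar> \<le> prim (\<lambda>s. \<bar>g s\<bar>) t"
  unfolding prim_def
  by (rule order_trans[OF integral_abs_bound]) (simp add: abs_mult)

lemma prim_0: "prim g 0 = 0"
  unfolding prim_def by (rule integral_eq_zero_AE) (auto simp: indicator_def)

lemma prim_1: "prim g 1 = (LINT s|unit_interval. g s)"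
  unfolding prim_def by (rule Bochner_Integration.integral_cong) auto

lemma tail_1: "tail f 1 = 0"
  by (simp add: tail_def prim_1)

text \<open>Dominated convergence with bound |g|: if X n tends to x, the indicators of {..X n}
  converge at every point except possibly x, which is a null set.\<close>

lemma prim_continuous:
  assumes "integrable unit_interval g"
  shows "continuous_on UNIV (prim g)"
proof -
  have "(\<lambda>n. prim g (X n)) \<longlonglongrightarrow> prim g x" if X: "X \<longlonglongrightarrow> x" for X x
    unfolding prim_def
  proof (rule integral_dominated_convergence[where w = "\<lambda>s. \<bar>g s\<bar>"])
    show "AE s in unit_interval. (\<lambda>n. indicator {..X n} s * g s) \<longlonglongrightarrow> indicator {..x} s * g s"
      using AE_unit_interval_neq
    proof eventually_elim
      fix s assume "s \<noteq> x"
      then have "eventually (\<lambda>n. indicator {..X n} s = (indicator {..x} s :: real)) sequentially"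
      proof (cases "s < x")
        case True
        from order_tendstoD(1)[OF X this] show ?thesis
          by eventually_elim (use True in \<open>auto simp: indicator_def\<close>)
      next
        case False
        with \<open>s \<noteq> x\<close> have "x < s" by auto
        from order_tendstoD(2)[OF X this] show ?thesis
          by eventually_elim (use \<open>x < s\<close> in \<open>auto simp: indicator_def\<close>)
      qed
      then have "eventually (\<lambda>n. indicator {..X n} s * g s = indicator {..x} s * g s) sequentially"
        by eventually_elim simp
      then show "(\<lambda>n. indicator {..X n} s * g s) \<longlonglongrightarrow> indicator {..x} s * g s"
        by (rule tendsto_eventually)
    qed
    show "(\<lambda>s. indicator {..x} s * g s) \<in> borel_measurable unit_interval"
      "(\<lambda>s. indicator {..X n} s * g s) \<in> borel_measurable unit_interval" for n
      using assms by (auto intro!: borel_measurable_times)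
    show "AE s in unit_interval. norm (indicator {..X n} s * g s) \<le> \<bar>g s\<bar>" for n
      by (simp add: indicator_def)
  qed (use assms in simp)
  then show ?thesis
    by (auto simp: continuous_on_sequentially o_def)
qed

lemma prim_increment:
  assumes "integrable unit_interval g" "s \<le> t"
  shows "prim g t - prim g s = (LINT r|unit_interval. indicator {s<..t} r * g r)"
  unfolding prim_def
  by (subst Bochner_Integration.integral_diff[OF assms(1)[THEN integrable_indicator_mult] assms(1)[THEN integrable_indicator_mult], symmetric],
      rule Bochner_Integration.integral_cong) (use assms(2) in \<open>auto simp: indicator_def\<close>)

lemma prim_mono_arg:
  assumes "integrable unit_interval g" "\<And>s. 0 < s \<Longrightarrow> s < 1 \<Longrightarrow> 0 \<le> g s" "s \<le> t"
  shows "prim g s \<le> prim g t"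
proof -
  have "0 \<le> (LINT r|unit_interval. indicator {s<..t} r * g r)"
    by (rule Bochner_Integration.integral_nonneg) (use assms(2) in auto)
  then show ?thesis using prim_increment[OF assms(1,3)] by simp
qed

lemma tail_eq:
  assumes "integrable unit_interval f"
  shows "tail f t = (LINT s|unit_interval. indicator {t<..} s * f s)"
proof -
  have "tail f t = (LINT s|unit_interval. f s - indicator {..t} s * f s)"
    using assms integrable_indicator_mult[OF assms] by (simp add: tail_def prim_def)
  also have "\<dots> = (LINT s|unit_interval. indicator {t<..} s * f s)"
    by (rule Bochner_Integration.integral_cong) (auto simp: indicator_def)
  finally show ?thesis .
qed

lemma prim_increment_le:
  assumes g: "g \<in> borel_measurable unit_interval" "\<And>s. 0 < s \<Longrightarrow> s < 1 \<Longrightarrow> \<bar>g s\<bar> \<le> C"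
    and st: "0 \<le> s" "s \<le> t" "t \<le> 1"
  shows "\<bar>prim g t - prim g s\<bar> \<le> C * (t - s)"
proof -
  have ig: "integrable unit_interval g" using g by (rule integrable_unit_interval_bounded)
  let ?I = "\<lambda>r. indicator {s<..t} r :: real"
  have iI: "integrable unit_interval ?I"
    by (rule integrable_unit_interval_bounded[where C = 1]) auto
  have "prim g t - prim g s = (LINT r|unit_interval. ?I r * g r)"
    by (rule prim_increment[OF ig st(2)])
  also have "\<bar>\<dots>\<bar> \<le> (LINT r|unit_interval. \<bar>?I r * g r\<bar>)"
    by (rule integral_abs_bound)
  also have "\<dots> \<le> (LINT r|unit_interval. C * ?I r)"
  proof (rule integral_mono)
    show "integrable unit_interval (\<lambda>r. \<bar>?I r * g r\<bar>)"
      by (intro integrable_abs integrable_mult_bounded[where C = 1] ig) auto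
    show "integrable unit_interval (\<lambda>r. C * ?I r)" using iI by auto
  qed (use g in \<open>auto simp: indicator_def\<close>)
  also have "\<dots> = C * (LINT r|unit_interval. ?I r)" by simp
  also have "(LINT r|unit_interval. ?I r) = measure unit_interval ({s<..t} \<inter> {0<..<1})"
    by (simp add: Int_commute)
  also have "\<dots> = measure lebesgue ({s<..t} \<inter> {0<..<1})"
    by (subst measure_restrict_space) auto
  \<comment> \<open>The base space is the open interval, so for t = 1 the right end point is missing
    from the intersection.\<close>
  also have "{s<..t} \<inter> {0<..<1} = (if t < 1 then {s<..t} else {s<..<1})"
    using st by auto
  also have "measure lebesgue \<dots> = t - s"
    using st by (auto simp: measure_completion)
  finally show ?thesis .
qed

lemma prim_lipschitz:
  assumes g: "g \<in> borel_measurable unit_interval" "\<And>s. 0 < s \<Longrightarrow> s < 1 \<Longrightarrow> \<bar>g s\<bar> \<le> C"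
    and st: "s \<in> {0..1}" "t \<in> {0..1}"
  shows "\<bar>prim g t - prim g s\<bar> \<le> C * \<bar>t - s\<bar>"
  using prim_increment_le[OF g, of s t] prim_increment_le[OF g, of t s] st
  by (cases "s \<le> t") (auto simp: abs_minus_commute)

text \<open>Both sides integrate f(t) g(s) over the triangle s \<le> t. This is integration by parts
  without derivatives; later it moves the load from the displacement to the moment.\<close>

lemma prim_Fubini:
  assumes f: "integrable unit_interval f" and g: "integrable unit_interval g"
  shows "(LINT t|unit_interval. f t * prim g t) = (LINT s|unit_interval. g s * tail f s)"
proof -
  interpret P: pair_sigma_finite unit_interval unit_interval ..
  have [measurable]: "f \<in> borel_measurable unit_interval" "g \<in> borel_measurable unit_interval"
    using f g by auto
  have le[measurable]: "Measurable.pred (unit_interval \<Otimes>\<^sub>M unit_interval) (\<lambda>x. snd x \<le> fst x)"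
  proof -
    have id: "(\<lambda>x. x) \<in> borel_measurable unit_interval"
      by (rule borel_imp_measurable_unit_interval) simp
    show ?thesis
      unfolding pred_def
      by (rule borel_measurable_le measurable_compose[OF measurable_snd id] measurable_compose[OF measurable_fst id])+
  qed
  let ?h = "\<lambda>(t,s). f t * (indicator {..t} s * g s)"
  have hh: "?h = (\<lambda>x. if snd x \<le> fst x then f (fst x) * g (snd x) else 0)"
    by (auto simp: fun_eq_iff indicator_def)
  have int: "integrable (unit_interval \<Otimes>\<^sub>M unit_interval) ?h"
  proof (rule Bochner_Integration.integrable_bound)
    show "integrable (unit_interval \<Otimes>\<^sub>M unit_interval) (\<lambda>(t,s). f t * g s)"
    proof (rule P.Fubini_integrable)
      show "(\<lambda>(t,s). f t * g s) \<in> borel_measurable (unit_interval \<Otimes>\<^sub>M unit_interval)"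
        by measurable
      show "integrable unit_interval (\<lambda>x. LINT y|unit_interval. norm (case (x, y) of (t, s) \<Rightarrow> f t * g s))"
        using f by (auto simp: abs_mult)
      show "AE x in unit_interval. integrable unit_interval (\<lambda>y. case (x, y) of (t, s) \<Rightarrow> f t * g s)"
        using g by auto
    qed
    show "?h \<in> borel_measurable (unit_interval \<Otimes>\<^sub>M unit_interval)"
      unfolding hh by measurable
  qed (auto simp: indicator_def)
  have "(LINT t|unit_interval. f t * prim g t) =
        (LINT t|unit_interval. (LINT s|unit_interval. f t * (indicator {..t} s * g s)))"
    by (simp add: prim_def)
  also have "\<dots> = (LINT s|unit_interval. (LINT t|unit_interval. f t * (indicator {..t} s * g s)))"
    using P.Fubini_integral[OF int] by simp
  also have "\<dots> = (LINT s|unit_interval. g s * tail f s)"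
  proof (rule Bochner_Integration.integral_cong[OF refl])
    fix s :: real
    \<comment> \<open>For fixed s the triangle leaves t in {s..}, whereas \<open>tail\<close>
      integrates over {s<..}; the two differ only at t = s.\<close>
    have "AE t in unit_interval. f t * (indicator {..t} s * g s) = g s * (f t - indicator {..s} t * f t)"
      using AE_unit_interval_neq by eventually_elim (auto simp: indicator_def)
    note ae = this
    have "(LINT t|unit_interval. f t * (indicator {..t} s * g s)) =
          (LINT t|unit_interval. g s * (f t - indicator {..s} t * f t))"
    proof (rule integral_cong_AE[OF _ _ ae])
      have "(\<lambda>t. f t * (indicator {..t} s * g s)) = (\<lambda>t. f t * (indicator {s..} t * g s))"
        by (auto simp: indicator_def)
      then show "(\<lambda>t. f t * (indicator {..t} s * g s)) \<in> borel_measurable unit_interval"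
        by (simp only:) measurable
    qed auto
    also have "\<dots> = g s * tail f s"
      using f integrable_indicator_mult[OF f] by (simp add: tail_def prim_def)
    finally show "(LINT t|unit_interval. f t * (indicator {..t} s * g s)) = g s * tail f s" .
  qed
  finally show ?thesis .
qed

text \<open>The Lebesgue integral against the indicator equals the Henstock-Kurzweil integral over
  [0,t], for which the fundamental theorem of calculus is stated.\<close>

lemma FTC_prim:
  assumes "continuous_on UNIV f" "\<And>x. (F has_real_derivative f x) (at x)" "0 \<le> t" "t \<le> 1"
  shows "prim f t = F t - F 0"
proof -
  have f: "continuous_on A f" for A using assms(1) continuous_on_subset by blast
  have i: "integrable unit_interval (\<lambda>s. indicator {..t} s * f s)"
    by (intro integrable_indicator_mult integrable_unit_interval_continuous f)
  have "prim f t = integral {0<..<1} (\<lambda>s. indicator {..t} s * f s)"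
    unfolding prim_def by (rule lebesgue_integral_eq_integral[OF i]) auto
  also have "\<dots> = integral {0..1} (\<lambda>s. indicator {..t} s * f s)"
    using integral_open_interval_real[of 0 1 "\<lambda>s. indicator {..t} s * f s"] by simp
  also have "\<dots> = integral {0..1} (\<lambda>s. if s \<in> {0..t} then f s else 0)"
    by (rule integral_cong) (auto simp: indicator_def)
  also have "\<dots> = integral {0..t} f"
    using assms by (subst integral_restrict_Int) (simp add: Int_atLeastAtMost min_def)
  also have "\<dots> = F t - F 0"
    by (rule integral_unique, rule fundamental_theorem_of_calculus)
       (use assms in \<open>auto simp: has_real_derivative_iff_has_vector_derivative intro: has_vector_derivative_at_within\<close>)
  finally show ?thesis .
qed

section \<open>Weak derivatives\<close>

text \<open>Extend g by zero and pass to a Borel representative h. The measures whose densities are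
  the positive and the negative part of h agree, with finite values, on all half-lines {x<..}. So
  they are equal, and uniqueness of densities gives h = 0 a.e.\<close>

lemma AE_eq_0_if_prim_eq_0:
  assumes g: "integrable unit_interval g" and 0: "\<And>t. t \<in> {0..1} \<Longrightarrow> prim g t = 0"
  shows "AE t in unit_interval. g t = 0"
proof -
  let ?g = "\<lambda>t. if t \<in> {0<..<1} then g t else 0"
  have ig: "integrable lebesgue ?g"
    using g by (subst Lebesgue_Measure.integrable_restrict_UNIV) auto
  then obtain h where h[measurable]: "h \<in> borel_measurable lborel" and gh: "AE t in lborel. ?g t = h t"
    using completion_ex_borel_measurable_real[of ?g lborel] by auto
  have gh': "AE t in lebesgue. ?g t = h t" using gh by (rule AE_completion)
  have hm: "h \<in> borel_measurable lebesgue" using h by (rule measurable_completion)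
  have "integrable lebesgue h"
    by (rule integrable_cong_AE_imp[OF ig hm gh'])
  then have ih: "integrable lborel h" using h by (simp add: integrable_completion)
  have half: "(LINT t|lborel. indicator {x<..} t * h t) = 0" for x
  proof -
    have "(LINT t|lborel. indicator {x<..} t * h t) = (LINT t|lebesgue. indicator {x<..} t * h t)"
      by (rule integral_completion[symmetric]) simp
    also have "\<dots> = (LINT t|lebesgue. (if t \<in> {0<..<1} then indicator {x<..} t * g t else 0))"
    proof (rule integral_cong_AE)
      have eq: "(\<lambda>t. if t \<in> {0<..<1} then indicator {x<..} t * g t else 0) = (\<lambda>t. indicator {x<..} t * ?g t)"
        by auto
      have ind: "(\<lambda>t. indicator {x<..} t :: real) \<in> borel_measurable lebesgue"
        by (rule measurable_completion) simp
      show "(\<lambda>t. indicator {x<..} t * h t) \<in> borel_measurable lebesgue"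
        by (intro borel_measurable_times ind hm)
      show "(\<lambda>t. if t \<in> {0<..<1} then indicator {x<..} t * g t else 0) \<in> borel_measurable lebesgue"
        unfolding eq using ig by (intro borel_measurable_times ind) auto
      show "AE t in lebesgue. indicator {x<..} t * h t = (if t \<in> {0<..<1} then indicator {x<..} t * g t else 0)"
        using gh' by eventually_elim auto
    qed
    also have "\<dots> = (LINT t|unit_interval. indicator {x<..} t * g t)"
      by (rule Lebesgue_Measure.integral_restrict_UNIV) auto
    also have "\<dots> = (LINT t|unit_interval. g t - indicator {..x} t * g t)"
      by (rule Bochner_Integration.integral_cong) (auto simp: indicator_def)
    also have "\<dots> = prim g 1 - prim g x"
      using g integrable_indicator_mult[OF g] by (simp add: prim_1) (simp add: prim_def)
    also have "\<dots> = 0"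
    proof (cases "x \<in> {0..1}")
      case True
      then show ?thesis using 0 by simp
    next
      case False
      have "prim g x = (if x < 0 then prim g 0 else prim g 1)"
        unfolding prim_def using False
        by (auto intro!: Bochner_Integration.integral_cong simp: indicator_def)
      then show ?thesis using 0 by auto
    qed
    finally show ?thesis .
  qed
  \<comment> \<open>\<open>ennreal\<close> sends negative numbers to 0, so these are the positive
    and the negative part of h.\<close>
  let ?P = "\<lambda>t. ennreal (h t)" and ?N = "\<lambda>t. ennreal (- h t)"
  have em: "emeasure (density lborel (\<lambda>t. ennreal (f t))) {x<..} = ennreal (LINT t|lborel. indicator {x<..} t * max 0 (f t))"
    if f: "integrable lborel f" for f :: "real \<Rightarrow> real" and x
  proof -
    have f'[measurable]: "f \<in> borel_measurable lborel" using f by auto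
    have "emeasure (density lborel (\<lambda>t. ennreal (f t))) {x<..} = (\<integral>\<^sup>+t. ennreal (f t) * indicator {x<..} t \<partial>lborel)"
      by (rule emeasure_density) auto
    also have "\<dots> = (\<integral>\<^sup>+t. ennreal (indicator {x<..} t * max 0 (f t)) \<partial>lborel)"
      by (rule nn_integral_cong) (auto simp: indicator_def max_def ennreal_neg)
    also have "\<dots> = ennreal (LINT t|lborel. indicator {x<..} t * max 0 (f t))"
    proof (rule nn_integral_eq_integral)
      have "integrable lborel (\<lambda>t. max 0 (f t))"
        using f by (intro integrable_max) auto
      then show "integrable lborel (\<lambda>t. indicator {x<..} t * max 0 (f t))"
        by (rule Bochner_Integration.integrable_bound) (auto simp: indicator_def)
    qed auto
    finally show ?thesis .
  qed
  have eq: "(LINT t|lborel. indicator {x<..} t * max 0 (h t)) = (LINT t|lborel. indicator {x<..} t * max 0 (- h t))" for x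
  proof -
    have i: "integrable lborel (\<lambda>t. indicator {x<..} t * max 0 (f t))" if "integrable lborel f" for f :: "real \<Rightarrow> real"
      using that by (rule Bochner_Integration.integrable_bound[where g = "\<lambda>t. indicator {x<..} t * max 0 (f t)"])
        (use that in \<open>auto simp: indicator_def\<close>)
    have "(LINT t|lborel. indicator {x<..} t * max 0 (h t)) - (LINT t|lborel. indicator {x<..} t * max 0 (- h t)) =
       (LINT t|lborel. indicator {x<..} t * max 0 (h t) - indicator {x<..} t * max 0 (- h t))"
      using i[of h] i[of "\<lambda>t. - h t"] ih by simp
    also have "\<dots> = (LINT t|lborel. indicator {x<..} t * h t)"
      by (rule Bochner_Integration.integral_cong) (auto simp: indicator_def)
    finally show ?thesis using half[of x] by simp
  qed
  have "density lborel ?P = density lborel ?N"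
    by (rule measure_eqI_lessThan) (use em[of h] em[of "\<lambda>t. - h t"] eq ih in auto)
  then have "AE t in lborel. ?P t = ?N t"
    by (subst (asm) sigma_finite_measure.density_unique_iff[OF sigma_finite_lborel]) auto
  then have "AE t in lborel. h t = 0"
  proof eventually_elim
    fix t assume e: "ennreal (h t) = ennreal (- h t)"
    show "h t = 0"
    proof (cases "0 \<le> h t")
      case True
      with e have "ennreal (h t) = 0" by (simp add: ennreal_neg)
      with True show ?thesis by (simp add: ennreal_eq_0_iff)
    next
      case False
      with e have "ennreal (- h t) = 0" by (simp add: ennreal_neg)
      with False show ?thesis by (simp add: ennreal_eq_0_iff)
    qed
  qed
  with gh have "AE t in lborel. ?g t = 0" by eventually_elim simp
  then have "AE t in lebesgue. ?g t = 0" by (rule AE_completion)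
  then have "AE t in lebesgue. t \<in> {0<..<1} \<longrightarrow> g t = 0" by eventually_elim auto
  then show ?thesis by (subst AE_restrict_space_iff) auto
qed

text \<open>The set in (0,1) where f and g differ is open and null, hence empty; continuity carries
  the equality to the end points.\<close>

lemma continuous_AE_eq:
  fixes f g :: "real \<Rightarrow> real"
  assumes f: "continuous_on {0..1} f" and g: "continuous_on {0..1} g"
    and ae: "AE t in unit_interval. f t = g t" and t: "t \<in> {0..1}"
  shows "f t = g t"
proof -
  let ?A = "{0<..<1} \<inter> {t. f t - g t \<noteq> 0}"
  have c: "continuous_on {0..1} (\<lambda>t. f t - g t)" by (intro continuous_intros f g)
  then have "continuous_on {0<..<1} (\<lambda>t. f t - g t)" by (rule continuous_on_subset) auto
  then have op: "open ?A"
    using continuous_open_preimage[of "{0<..<1}" "\<lambda>t. f t - g t" "- {0}"]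
    by (simp add: vimage_def open_Compl)
  have "AE t in lebesgue. t \<in> {0<..<1} \<longrightarrow> f t = g t"
    using ae by (subst (asm) AE_restrict_space_iff) auto
  then have "AE t in lebesgue. t \<notin> ?A" by eventually_elim auto
  then have "?A \<in> null_sets lebesgue"
    using op by (subst AE_iff_null_sets) auto
  then have "negligible ?A" by (simp add: negligible_iff_null_sets)
  then have A: "?A = {}" using op open_not_negligible by blast
  have "closure {0<..<1::real} = {0..1}" by simp
  then have "f t - g t = 0"
    by (intro continuous_constant_on_closure[of "{0<..<1}" "\<lambda>t. f t - g t" 0 t]) (use c A t in auto)
  then show ?thesis by simp
qed

lemma test_functionD:
  assumes "\<phi> \<in> test_functions"
  shows "continuous_on UNIV (deriv \<phi>)"
    "\<And>t. (\<phi> has_real_derivative deriv \<phi> t) (at t)" "\<phi> 0 = 0" "\<phi> 1 = 0"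
proof -
  from assms have C1: "\<phi> C1_differentiable_on UNIV" and S: "closure {t. \<phi> t \<noteq> 0} \<subseteq> {0<..<1}"
    by (auto simp: test_functions_def)
  from C1 obtain D where D: "\<And>x. (\<phi> has_vector_derivative D x) (at x)" "continuous_on UNIV D"
    unfolding C1_differentiable_on_def by auto
  have D': "(\<phi> has_real_derivative D x) (at x)" for x
    using D(1) by (simp add: has_real_derivative_iff_has_vector_derivative)
  then have "deriv \<phi> = D" by (auto intro!: DERIV_imp_deriv)
  with D D' show "continuous_on UNIV (deriv \<phi>)" "\<And>t. (\<phi> has_real_derivative deriv \<phi> t) (at t)"
    by auto
  show "\<phi> 0 = 0" "\<phi> 1 = 0"
    using S closure_subset[of "{t. \<phi> t \<noteq> 0}"] by force+
qed

text \<open>A test function \<phi> vanishes at 0 and 1, so \<open>tail\<close> of its derivative is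
  -\<phi> on the interval, and \<open>prim_Fubini\<close> becomes the required identity.\<close>

lemma prim_is_weak_deriv:
  assumes g: "integrable unit_interval g" and K: "\<And>t. t \<in> {0<..<1} \<Longrightarrow> K t = prim g t"
  shows "is_weak_deriv K g"
  unfolding is_weak_deriv_def
proof
  fix \<phi> assume "\<phi> \<in> test_functions"
  note F = test_functionD[OF this]
  have c: "continuous_on {0..1} (deriv \<phi>)" using F(1) continuous_on_subset by blast
  then have i: "integrable unit_interval (deriv \<phi>)" by (rule integrable_unit_interval_continuous)
  have p: "prim (deriv \<phi>) t = \<phi> t" if "0 \<le> t" "t \<le> 1" for t
    using FTC_prim[OF F(1) F(2) that] F(3) by simp
  have "(LINT t|unit_interval. K t * deriv \<phi> t) = (LINT t|unit_interval. deriv \<phi> t * prim g t)"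
    by (rule Bochner_Integration.integral_cong) (use K in auto)
  also have "\<dots> = (LINT t|unit_interval. g t * tail (deriv \<phi>) t)"
    by (rule prim_Fubini[OF i g])
  also have "\<dots> = (LINT t|unit_interval. - (g t * \<phi> t))"
    by (rule Bochner_Integration.integral_cong) (use p p[of 1] F(4) in \<open>auto simp: tail_def prim_1\<close>)
  finally show "(LINT t|unit_interval. K t * deriv \<phi> t) = - (LINT t|unit_interval. g t * \<phi> t)"
    by simp
qed

text \<open>Take the antiderivative of \<psi> that vanishes at 0. It is constant to the left of d
  and to the right of 1 - d. The left constant is its value at 0, the right one its value at 1,
  which is the integral of \<psi>.\<close>

lemma cutoff_test_function:
  assumes \<psi>: "continuous_on UNIV \<psi>" and d: "0 < d" "d < 1/2"
    and 0: "\<And>t. t \<notin> {d..1-d} \<Longrightarrow> \<psi> t = 0" and int: "(LINT t|unit_interval. \<psi> t) = 0"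
  obtains \<phi> where "\<phi> \<in> test_functions" "deriv \<phi> = \<psi>"
proof -
  obtain F where F: "\<And>x. (F has_vector_derivative \<psi> x) (at x)"
    using einterval_antiderivative[of "-\<infinity>" \<infinity> \<psi>] \<psi> by (auto simp: continuous_on_eq_continuous_at)
  then have F': "(F has_real_derivative \<psi> x) (at x)" for x
    by (simp add: has_real_derivative_iff_has_vector_derivative)
  define \<phi> where "\<phi> = (\<lambda>x. F x - F 0)"
  have D: "(\<phi> has_real_derivative \<psi> x) (at x)" for x
    unfolding \<phi>_def by (auto intro!: derivative_eq_intros F')
  then have d\<phi>: "deriv \<phi> = \<psi>" by (auto intro!: DERIV_imp_deriv)
  have "\<phi> 1 = 0"
    using FTC_prim[OF \<psi> F', of 1] int by (simp add: prim_1 \<phi>_def)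
  have L: "\<phi> x = 0" if "x < d" for x
  proof -
    have "\<exists>c. \<forall>x\<in>{..<d}. \<phi> x = c"
    proof (rule has_field_derivative_zero_constant)
      show "(\<phi> has_field_derivative 0) (at x within {..<d})" if "x \<in> {..<d}" for x
        using D[of x] 0[of x] that by (auto intro: has_field_derivative_at_within)
    qed auto
    then obtain c where c: "\<And>x. x < d \<Longrightarrow> \<phi> x = c" by auto
    from c[of 0] d have "c = 0" by (simp add: \<phi>_def)
    with c that show ?thesis by simp
  qed
  have R: "\<phi> x = 0" if "x > 1 - d" for x
  proof -
    have "\<exists>c. \<forall>x\<in>{1-d<..}. \<phi> x = c"
    proof (rule has_field_derivative_zero_constant)
      show "(\<phi> has_field_derivative 0) (at x within {1-d<..})" if "x \<in> {1-d<..}" for x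
        using D[of x] 0[of x] that by (auto intro: has_field_derivative_at_within)
    qed auto
    then obtain c where c: "\<And>x. x > 1 - d \<Longrightarrow> \<phi> x = c" by auto
    from c[of 1] d \<open>\<phi> 1 = 0\<close> have "c = 0" by simp
    with c that show ?thesis by simp
  qed
  have "{t. \<phi> t \<noteq> 0} \<subseteq> {d..1-d}" using L R by force
  then have S: "closure {t. \<phi> t \<noteq> 0} \<subseteq> {d..1-d}" by (intro closure_minimal) auto
  then have "compact (closure {t. \<phi> t \<noteq> 0})"
    by (intro compact_eq_bounded_closed[THEN iffD2] conjI) (auto intro: bounded_subset[OF bounded_closed_interval])
  moreover have "\<phi> C1_differentiable_on UNIV"
    unfolding C1_differentiable_on_def using D \<psi>
    by (auto simp: has_real_derivative_iff_has_vector_derivative intro!: exI[of _ \<psi>])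
  ultimately have "\<phi> \<in> test_functions"
    using S d by (auto simp: test_functions_def subset_iff)
  with d\<phi> that show ?thesis by blast
qed

text \<open>du Bois-Reymond's lemma: test with $\varphi' = \eta (w - c)$, where $\eta \ge 0$ is a cutoff and
  the constant $c$ makes $\varphi'$ integrate to zero.\<close>

lemma constant_if_orthogonal_to_derivs:
  assumes w: "continuous_on {0..1} w"
    and orth: "\<And>\<phi>. \<phi> \<in> test_functions \<Longrightarrow> (LINT t|unit_interval. w t * deriv \<phi> t) = 0"
    and d: "0 < d" "d < 1/2"
  shows "\<exists>c. \<forall>t\<in>{d<..<1-d}. w t = c"
proof -
  \<comment> \<open>Clamping the argument to [0,1] extends w continuously to the real line, as
    \<open>cutoff_test_function\<close> requires.\<close>
  let ?cl = "\<lambda>t. max 0 (min 1 t) :: real"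
  let ?W = "\<lambda>t. w (?cl t)"
  have W: "continuous_on UNIV ?W"
    by (rule continuous_on_compose2[OF w]) (auto intro!: continuous_intros)
  let ?e = "\<lambda>t. max 0 ((t - d) * (1 - d - t))"
  have e: "continuous_on UNIV ?e" by (intro continuous_intros)
  have e0: "?e t = 0" if "t \<notin> {d..1-d}" for t
    using that d by (auto simp: max_def mult_le_0_iff zero_le_mult_iff)
  have ep: "?e t > 0" if "t \<in> {d<..<1-d}" for t
    using that by (auto simp: max_def)
  have integ: "integrable unit_interval f" if "continuous_on UNIV f" for f :: "real \<Rightarrow> real"
    using that by (intro integrable_unit_interval_continuous) (rule continuous_on_subset, auto)
  have zero: "f t = 0" if f: "continuous_on UNIV f" "\<And>t. 0 \<le> f t" "(LINT t|unit_interval. f t) = 0" "t \<in> {0..1}"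
    for f :: "real \<Rightarrow> real" and t
  proof (rule continuous_AE_eq[where f = f and g = "\<lambda>_. 0" and t = t])
    show "AE t in unit_interval. f t = 0"
      using integral_nonneg_eq_0_iff_AE[OF integ[OF f(1)]] f by auto
  qed (use f in \<open>auto intro: continuous_on_subset\<close>)
  let ?Z = "LINT t|unit_interval. ?e t"
  have Z: "?Z \<noteq> 0"
  proof
    assume "?Z = 0"
    from zero[OF e _ this, of "1/2"] ep[of "1/2"] d show False by auto
  qed
  define c where "c = (LINT t|unit_interval. ?e t * ?W t) / ?Z"
  let ?\<psi> = "\<lambda>t. ?e t * (?W t - c)"
  have c\<psi>: "continuous_on UNIV ?\<psi>" by (intro continuous_intros W)
  have i1: "integrable unit_interval (\<lambda>t. ?e t * ?W t)"
    by (rule integ) (intro continuous_intros W)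
  have "(LINT t|unit_interval. ?\<psi> t) = (LINT t|unit_interval. ?e t * ?W t - c * ?e t)"
    by (rule Bochner_Integration.integral_cong) (auto simp: algebra_simps)
  also have "\<dots> = 0"
    using i1 integ[OF e] Z by (simp add: c_def)
  finally have I0: "(LINT t|unit_interval. ?\<psi> t) = 0" .
  obtain \<phi> where \<phi>: "\<phi> \<in> test_functions" "deriv \<phi> = ?\<psi>"
    by (rule cutoff_test_function[OF c\<psi> d _ I0]) (use e0 in auto)
  have i2: "integrable unit_interval (\<lambda>t. ?W t * ?\<psi> t)"
    by (rule integ) (intro continuous_intros W)
  \<comment> \<open>With \<psi> = e (W - c) the integrand is W \<psi> - c \<psi>. The second term
    integrates to zero by the choice of c, the first because \<psi> is the derivative of a test
    function.\<close>
  have "(LINT t|unit_interval. ?e t * (?W t - c)\<^sup>2) = (LINT t|unit_interval. ?W t * ?\<psi> t - c * ?\<psi> t)"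
    by (rule Bochner_Integration.integral_cong) (auto simp: algebra_simps power2_eq_square)
  also have "\<dots> = (LINT t|unit_interval. ?W t * ?\<psi> t)"
    using i2 integ[OF c\<psi>] I0 by simp
  also have "\<dots> = (LINT t|unit_interval. w t * deriv \<phi> t)"
    by (rule Bochner_Integration.integral_cong) (auto simp: \<phi>)
  also have "\<dots> = 0" by (rule orth[OF \<phi>(1)])
  finally have E0: "(LINT t|unit_interval. ?e t * (?W t - c)\<^sup>2) = 0" .
  have "w t = c" if t: "t \<in> {d<..<1-d}" for t
  proof -
    have "?e t * (?W t - c)\<^sup>2 = 0"
      by (rule zero[OF _ _ E0]) (use t d in \<open>auto intro!: continuous_intros W\<close>)
    then show ?thesis using ep[OF t] t d by auto
  qed
  then show ?thesis by blast
qed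

lemma L2_imp_integrable:
  assumes "g \<in> L2"
  shows "integrable unit_interval g" "integrable unit_interval (\<lambda>t. (g t)\<^sup>2)"
proof -
  show sq: "integrable unit_interval (\<lambda>t. (g t)\<^sup>2)" using assms by (simp add: L2_def)
  have le: "\<bar>x\<bar> \<le> 1 + x\<^sup>2" for x :: real
    using sum_squares_bound[of "\<bar>x\<bar>" 1] by simp
  show "integrable unit_interval g"
  proof (rule Bochner_Integration.integrable_bound)
    show "integrable unit_interval (\<lambda>t. 1 + (g t)\<^sup>2)" using sq by simp
    show "AE t in unit_interval. norm (g t) \<le> norm (1 + (g t)\<^sup>2)"
      using le by (auto intro!: AE_I2 order_trans[OF le])
  qed (use assms in \<open>simp add: L2_def\<close>)
qed

text \<open>The difference K - prim g has weak derivative zero, so it is constant on each interval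
  (d, 1 - d). These intervals all contain 1/2, which makes the constants equal, and the difference
  vanishes at 0.\<close>

lemma eq_prim_if_is_weak_deriv:
  assumes K: "continuous_on {0..1} K" "K 0 = 0" and g: "integrable unit_interval g" and wd: "is_weak_deriv K g"
    and t: "t \<in> {0..1}"
  shows "K t = prim g t"
proof -
  let ?w = "\<lambda>t. K t - prim g t"
  have pc: "continuous_on {0..1} (prim g)"
    using prim_continuous[OF g] continuous_on_subset by blast
  have w: "continuous_on {0..1} ?w" by (intro continuous_intros K pc)
  have orth: "(LINT t|unit_interval. ?w t * deriv \<phi> t) = 0" if \<phi>: "\<phi> \<in> test_functions" for \<phi>
  proof -
    have c: "continuous_on {0..1} (deriv \<phi>)" using test_functionD(1)[OF \<phi>] continuous_on_subset by blast
    have int: "integrable unit_interval (\<lambda>t. f t * deriv \<phi> t)" if "continuous_on {0..1} f" for f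
      by (intro integrable_unit_interval_continuous continuous_intros that c)
    have "is_weak_deriv (prim g) g" by (rule prim_is_weak_deriv[OF g]) simp
    with wd \<phi> have "(LINT t|unit_interval. K t * deriv \<phi> t) = (LINT t|unit_interval. prim g t * deriv \<phi> t)"
      by (auto simp: is_weak_deriv_def)
    then show ?thesis
      using int[OF K(1)] int[OF pc] by (simp add: left_diff_distrib)
  qed
  have const: "?w t = ?w (1/2)" if t: "t \<in> {0<..<1}" for t
  proof -
    define d where "d = min t (1 - t) / 2"
    have d: "0 < d" "d < 1/2" "t \<in> {d<..<1-d}" using t by (auto simp: d_def min_def field_simps)
    obtain c where "\<And>t. t \<in> {d<..<1-d} \<Longrightarrow> ?w t = c"
      using constant_if_orthogonal_to_derivs[OF w orth d(1,2)] by blast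
    from this[OF d(3)] this[of "1/2"] show ?thesis using d(2) by simp
  qed
  have cl: "?w t = ?w (1/2)" if "t \<in> {0..1}" for t
  proof (rule continuous_constant_on_closure[of "{0<..<1}" ?w])
    show "continuous_on (closure {0<..<1}) ?w" "t \<in> closure {0<..<1}" using w that by simp_all
  qed (rule const)
  from cl[OF t] cl[of 0] show ?thesis using K(2) by (simp add: prim_0)
qed

section \<open>The state equation characterises the state\<close>

text \<open>Integrating the state equation from t to 1 with the natural condition K'(1) = 0 gives B
  K' = -\<open>moment K\<close>. The boundary value problem thus becomes an integral equation, which
  makes sense for B that is only measurable and bounded below.\<close>

definition moment :: "(real \<Rightarrow> real) \<Rightarrow> real \<Rightarrow> real" where
  "moment k = tail (\<lambda>s. (1 - s) * cos (k s))"

lemma tail_lipschitz: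
  assumes "f \<in> borel_measurable unit_interval" "\<And>s. 0 < s \<Longrightarrow> s < 1 \<Longrightarrow> \<bar>f s\<bar> \<le> C"
    and "s \<in> {0..1}" "t \<in> {0..1}"
  shows "\<bar>tail f t - tail f s\<bar> \<le> C * \<bar>t - s\<bar>"
  using prim_lipschitz[OF assms] by (simp add: tail_def abs_minus_commute)

lemma tail_continuous:
  assumes "integrable unit_interval f"
  shows "continuous_on A (tail f)"
  unfolding tail_def
  by (intro continuous_intros) (use prim_continuous[OF assms] continuous_on_subset in blast)

lemma abs_tail_le:
  assumes "f \<in> borel_measurable unit_interval" "\<And>s. 0 < s \<Longrightarrow> s < 1 \<Longrightarrow> \<bar>f s\<bar> \<le> C"
    and t: "t \<in> {0..1}" and "0 \<le> C"
  shows "\<bar>tail f t\<bar> \<le> C"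
proof -
  have "\<bar>tail f t - tail f 1\<bar> \<le> C * \<bar>t - 1\<bar>" by (rule tail_lipschitz) (use assms in auto)
  also have "\<dots> \<le> C * 1" using t \<open>0 \<le> C\<close> by (intro mult_left_mono) auto
  finally show ?thesis by (simp add: tail_1)
qed

lemma load_bounds:
  assumes "k \<in> borel_measurable unit_interval"
  shows "(\<lambda>s. (1 - s) * cos (k s)) \<in> borel_measurable unit_interval"
    "\<And>s. 0 < s \<Longrightarrow> s < 1 \<Longrightarrow> \<bar>(1 - s) * cos (k s)\<bar> \<le> 1"
    "integrable unit_interval (\<lambda>s. (1 - s) * cos (k s))"
proof -
  have "(\<lambda>s. 1 - s :: real) \<in> borel_measurable unit_interval"
    by (rule borel_imp_measurable_unit_interval) simp
  then show m: "(\<lambda>s. (1 - s) * cos (k s)) \<in> borel_measurable unit_interval"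
    using assms by measurable
  show b: "\<bar>(1 - s) * cos (k s)\<bar> \<le> 1" if "0 < s" "s < 1" for s
    using that by (auto simp: abs_mult intro!: mult_le_one)
  show "integrable unit_interval (\<lambda>s. (1 - s) * cos (k s))"
    by (rule integrable_unit_interval_bounded[OF m b])
qed

lemma moment_bounds:
  assumes "continuous_on {0..1} k"
  shows "moment k \<in> borel_measurable unit_interval" "\<And>t. 0 < t \<Longrightarrow> t < 1 \<Longrightarrow> \<bar>moment k t\<bar> \<le> 1"
proof -
  note f = load_bounds[OF continuous_on_imp_measurable_unit_interval[OF assms]]
  show "moment k \<in> borel_measurable unit_interval"
    unfolding moment_def by (rule continuous_on_imp_measurable_unit_interval) (rule tail_continuous[OF f(3)])
  show "\<bar>moment k t\<bar> \<le> 1" if "0 < t" "t < 1" for t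
    unfolding moment_def by (rule abs_tail_le) (use f that in auto)
qed

text \<open>On [-pi,0] the cosine is increasing, so the sine is convex there; the mean value theorem
  is applied for either order of y and k.\<close>

lemma sin_ge_tangent:
  fixes y k :: real
  assumes "- pi \<le> y" "y \<le> 0" "- pi \<le> k" "k \<le> 0"
  shows "sin k + cos k * (y - k) \<le> sin y"
proof (cases y k rule: linorder_cases)
  case less
  obtain z where z: "y < z" "z < k" "sin k - sin y = (k - y) * cos z"
    using MVT2[OF less, of sin cos] by auto
  have "cos z \<le> cos k"
    using cos_monotone_minus_pi_0'[of z k] z assms by auto
  then have "(k - y) * cos z \<le> (k - y) * cos k"
    using less by (intro mult_left_mono) auto
  with z(3) show ?thesis by (simp add: algebra_simps)
next
  case greater
  obtain z where z: "k < z" "z < y" "sin y - sin k = (y - k) * cos z"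
    using MVT2[OF greater, of sin cos] by auto
  have "cos k \<le> cos z"
    using cos_monotone_minus_pi_0'[of k z] z assms by auto
  then have "(y - k) * cos k \<le> (y - k) * cos z"
    using greater by (intro mult_left_mono) auto
  with z(3) show ?thesis by (simp add: algebra_simps)
qed simp

text \<open>For $x = K(t)$ the bound $n = \int_0^t|K'|$ is available, so an arbitrary competitor $K$ is compared with
  the nonpositive one $-\int_0^t|K'|$ and no chain rule for $|K|$ is needed.\<close>

lemma sin_ge_reflected_tangent:
  fixes x k n :: real
  assumes k: "- (pi/2) \<le> k" "k \<le> 0" and n: "\<bar>x\<bar> \<le> n"
  shows "sin k - cos k * (n + k) \<le> sin x"
proof -
  have c: "0 \<le> cos k" using k by (intro cos_ge_zero) auto
  have "sin k + cos k * (- \<bar>x\<bar> - k) \<le> sin x"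
  \<comment> \<open>Up to pi/2 the tangent inequality applies at -|x|, and sin(-|x|) \<le> sin x.
    Beyond pi/2, the slope cos k is nonnegative, so the tangent at -|x| lies below its value at
    -pi/2, which is at most -1.\<close>
  proof (cases "\<bar>x\<bar> \<le> pi/2")
    case True
    then have "sin k + cos k * (- \<bar>x\<bar> - k) \<le> sin (- \<bar>x\<bar>)"
      using k by (intro sin_ge_tangent) auto
    also have "\<dots> \<le> sin x"
    proof (cases "0 \<le> x")
      case x: True
      then have "0 \<le> sin x" using True by (intro sin_ge_zero) auto
      with x show ?thesis by simp
    qed simp
    finally show ?thesis .
  next
    case False
    have "cos k * (- \<bar>x\<bar> - k) \<le> cos k * (- (pi/2) - k)"
      using False c by (intro mult_left_mono) auto
    then have "sin k + cos k * (- \<bar>x\<bar> - k) \<le> sin k + cos k * (- (pi/2) - k)" by simp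
    also have "\<dots> \<le> sin (- (pi/2))" using k by (intro sin_ge_tangent) auto
    also have "\<dots> \<le> sin x" by simp
    finally show ?thesis .
  qed
  moreover have "cos k * (- n - k) \<le> cos k * (- \<bar>x\<bar> - k)"
    using n c by (intro mult_left_mono) auto
  ultimately show ?thesis by (simp add: algebra_simps)
qed

lemma L2_bounded:
  assumes "f \<in> borel_measurable unit_interval" "\<And>t. 0 < t \<Longrightarrow> t < 1 \<Longrightarrow> \<bar>f t\<bar> \<le> C"
  shows "f \<in> L2"
  unfolding L2_def
proof (intro CollectI conjI)
  show "integrable unit_interval (\<lambda>t. (f t)\<^sup>2)"
  proof (rule integrable_unit_interval_bounded[where C = "C\<^sup>2"])
    show "\<bar>(f t)\<^sup>2\<bar> \<le> C\<^sup>2" if "0 < t" "t < 1" for t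
      using assms(2)[OF that] by (simp add: abs_le_square_iff[symmetric])
  qed (use assms in simp)
qed (use assms in simp)

lemma W12_l_weak_deriv:
  assumes K: "K \<in> W12_l"
  shows "weak_deriv K \<in> L2" "\<And>t. t \<in> {0..1} \<Longrightarrow> K t = prim (weak_deriv K) t"
proof -
  from K have "\<exists>g. g \<in> L2 \<and> is_weak_deriv K g" by (auto simp: W12_l_def W12_def)
  then have g: "weak_deriv K \<in> L2 \<and> is_weak_deriv K (weak_deriv K)"
    unfolding weak_deriv_def by (rule someI_ex)
  then show "weak_deriv K \<in> L2" by simp
  show "K t = prim (weak_deriv K) t" if "t \<in> {0..1}" for t
    by (rule eq_prim_if_is_weak_deriv) (use K g L2_imp_integrable that in \<open>auto simp: W12_l_def W12_def\<close>)
qed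

text \<open>\<open>weak_deriv\<close> selects an arbitrary representative. Its primitive is the
  given function again, hence the primitive of g, and \<open>AE_eq_0_if_prim_eq_0\<close> identifies
  the two a.e.\<close>

lemma restrict_prim_W12_l:
  assumes g: "g \<in> L2" and k: "\<And>t. t \<in> {0..1} \<Longrightarrow> k t = prim g t"
  shows "restrict k {0..1} \<in> W12_l" "AE t in unit_interval. weak_deriv (restrict k {0..1}) t = g t"
proof -
  let ?k = "restrict k {0..1}"
  have ig: "integrable unit_interval g" using L2_imp_integrable[OF g] by simp
  have kp: "?k t = prim g t" if "t \<in> {0..1}" for t using k that by simp
  have "continuous_on {0..1} (prim g)" using prim_continuous[OF ig] continuous_on_subset by blast
  then have c: "continuous_on {0..1} ?k" by (rule continuous_on_eq) (use kp in auto)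
  then have "bounded (?k ` {0..1})" by (intro compact_imp_bounded compact_continuous_image) auto
  then obtain C where C: "\<And>x. x \<in> {0..1} \<Longrightarrow> \<bar>?k x\<bar> \<le> C"
    unfolding bounded_iff real_norm_def by blast
  have "?k \<in> L2"
    by (rule L2_bounded[OF continuous_on_imp_measurable_unit_interval[OF c], of C]) (rule C, simp)
  moreover have "is_weak_deriv ?k g"
    by (rule prim_is_weak_deriv[OF ig]) (rule kp, simp)
  ultimately show W: "?k \<in> W12_l"
    using c g kp[of 0] by (auto simp: W12_l_def W12_def prim_0)
  have iw: "integrable unit_interval (weak_deriv ?k)"
    using L2_imp_integrable[OF W12_l_weak_deriv(1)[OF W]] by simp
  have "AE t in unit_interval. weak_deriv ?k t - g t = 0"
  proof (rule AE_eq_0_if_prim_eq_0)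
    show "integrable unit_interval (\<lambda>t. weak_deriv ?k t - g t)" using iw ig by simp
    show "prim (\<lambda>t. weak_deriv ?k t - g t) t = 0" if "t \<in> {0..1}" for t
      using W12_l_weak_deriv(2)[OF W that] kp[OF that] prim_diff[OF iw ig] by simp
  qed
  then show "AE t in unit_interval. weak_deriv ?k t = g t" by eventually_elim simp
qed

text \<open>For a competitor K put n = prim |K'|. The energy of K minus that of k equals 1/2 int B
  ((n + k)')^2 + int R, where R \<ge> 0 is the gap in \<open>sin_ge_reflected_tangent\<close> times
  1 - t. If both terms vanish, then n = -k, so |K| \<le> pi/2, and R = 0 leaves sin K = sin k; the
  sine is injective on that range.\<close>

lemma state_eqI:
  assumes B: "B \<in> borel_measurable unit_interval" "\<And>t. a \<le> B t" "\<And>t. B t \<le> b" and a: "0 < a"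
    and c: "continuous_on {0..1} k"
    and eq: "\<And>t. t \<in> {0..1} \<Longrightarrow> k t = - prim (\<lambda>s. moment k s / B s) t"
    and range: "\<And>t. t \<in> {0..1} \<Longrightarrow> - (pi/2) \<le> k t \<and> k t \<le> 0"
  shows "state B = restrict k {0..1}"
proof -
  let ?k = "restrict k {0..1}"
  let ?f = "\<lambda>s. (1 - s) * cos (k s)"
  note km = continuous_on_imp_measurable_unit_interval[OF c]
  note f = load_bounds[OF km]
  note pm[measurable] = moment_bounds(1)[OF c] and pb = moment_bounds(2)[OF c]
  have [measurable]: "B \<in> borel_measurable unit_interval" by (rule B)
  have Bpos: "0 < B t" for t using B(2)[of t] a by simp
  define h where "h = (\<lambda>s. - (moment k s / B s))"
  have hm[measurable]: "h \<in> borel_measurable unit_interval" unfolding h_def by measurable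
  have hb: "\<bar>h t\<bar> \<le> 1 / a" if "0 < t" "t < 1" for t
    unfolding h_def using pb[OF that] B(2)[of t] a by (auto simp: abs_div abs_of_pos[OF Bpos] intro!: frac_le)
  have Bh: "B t * h t = - moment k t" for t using Bpos[of t] by (simp add: h_def)
  have hL2: "h \<in> L2" by (rule L2_bounded[OF hm hb])
  have ih: "integrable unit_interval h" using L2_imp_integrable[OF hL2] by simp
  have kh: "k t = prim h t" if "t \<in> {0..1}" for t
    using eq[OF that] by (simp add: h_def prim_minus)
  have W: "?k \<in> W12_l" "AE t in unit_interval. weak_deriv ?k t = h t"
    by (rule restrict_prim_W12_l[OF hL2 kh]; assumption)+
  have im1: "(\<lambda>t. 1 - t :: real) \<in> borel_measurable unit_interval"
    by (rule borel_imp_measurable_unit_interval) simp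
  have isin: "integrable unit_interval (\<lambda>t. (1 - t) * sin (u t))"
    if "u \<in> borel_measurable unit_interval" for u
  proof (rule integrable_unit_interval_bounded[where C = 1])
    show "(\<lambda>t. (1 - t) * sin (u t)) \<in> borel_measurable unit_interval"
      using im1 that by measurable
  qed (auto simp: abs_mult intro!: mult_le_one)
  have iB: "integrable unit_interval (\<lambda>t. B t * u t)" if "integrable unit_interval u" for u
    by (rule integrable_mult_bounded[OF that B(1), of b]) (use B(3) Bpos in \<open>simp add: abs_of_pos\<close>)
  have "(LINT t|unit_interval. B t * (weak_deriv ?k t)\<^sup>2) = (LINT t|unit_interval. B t * (h t)\<^sup>2)"
  proof (rule integral_cong_AE)
    have "weak_deriv ?k \<in> borel_measurable unit_interval"
      using L2_imp_integrable(1)[OF W12_l_weak_deriv(1)[OF W(1)]] by simp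
    then show "(\<lambda>t. B t * (weak_deriv ?k t)\<^sup>2) \<in> borel_measurable unit_interval" by measurable
    show "AE t in unit_interval. B t * (weak_deriv ?k t)\<^sup>2 = B t * (h t)\<^sup>2"
      using W(2) by eventually_elim simp
  qed measurable
  moreover have "(LINT t|unit_interval. (1 - t) * sin (?k t)) = (LINT t|unit_interval. (1 - t) * sin (k t))"
    by (rule Bochner_Integration.integral_cong) auto
  ultimately have Ek: "energy B ?k = 1/2 * (LINT t|unit_interval. B t * (h t)\<^sup>2) + (LINT t|unit_interval. (1 - t) * sin (k t))"
    by (simp add: energy_def)
  have main: "energy B ?k \<le> energy B K \<and> (energy B K = energy B ?k \<longrightarrow> K = ?k)" if K: "K \<in> W12_l" for K
  proof -
    define g where "g = weak_deriv K"
    have gL2: "g \<in> L2" and Kg: "\<And>t. t \<in> {0..1} \<Longrightarrow> K t = prim g t"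
      using W12_l_weak_deriv[OF K] by (auto simp: g_def)
    note ig = L2_imp_integrable[OF gL2]
    have gm[measurable]: "g \<in> borel_measurable unit_interval" using ig(1) by auto
    have Kc: "continuous_on {0..1} K" using K by (simp add: W12_l_def W12_def)
    note Km = continuous_on_imp_measurable_unit_interval[OF Kc]
    \<comment> \<open>The derivative of k - (-n), where -n is the reflected competitor. Only |g|
      enters, yet its square is that of the true derivative of K.\<close>
    define v where "v = (\<lambda>t. \<bar>g t\<bar> + h t)"
    have iv: "integrable unit_interval v" unfolding v_def using ig(1) ih by simp
    have vm[measurable]: "v \<in> borel_measurable unit_interval" using iv by auto
    define n where "n = prim (\<lambda>t. \<bar>g t\<bar>)"
    have pv: "prim v t = n t + k t" if "t \<in> {0..1}" for t
      unfolding v_def n_def using prim_add[OF integrable_abs[OF ig(1)] ih, of t] kh[OF that] by simp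
    define R where "R = (\<lambda>t. (1 - t) * (sin (K t) - sin (k t)) + ?f t * prim v t)"
    have ifv: "integrable unit_interval (\<lambda>t. ?f t * prim v t)"
      by (intro integrable_unit_interval_continuous continuous_intros c continuous_on_subset[OF prim_continuous[OF iv]]) auto
    have iR: "integrable unit_interval R"
      unfolding R_def right_diff_distrib using isin[OF Km] isin[OF km] ifv by simp
    have Rnn: "0 \<le> R t" if t: "0 < t" "t < 1" for t
    proof -
      have "\<bar>K t\<bar> \<le> n t" unfolding n_def using Kg[of t] t abs_prim_le[of g t] by simp
      then have "sin (k t) - cos (k t) * (n t + k t) \<le> sin (K t)"
        using range[of t] t by (intro sin_ge_reflected_tangent) auto
      then have "0 \<le> (1 - t) * (sin (K t) - sin (k t) + cos (k t) * (n t + k t))"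
        using t by (intro mult_nonneg_nonneg) auto
      also have "\<dots> = R t" using pv[of t] t by (simp add: R_def algebra_simps)
      finally show ?thesis .
    qed
    have ip: "integrable unit_interval (\<lambda>t. moment k t * v t)"
      by (rule integrable_mult_bounded[OF iv pm pb])
    have F: "(LINT t|unit_interval. ?f t * prim v t) = (LINT t|unit_interval. moment k t * v t)"
      using prim_Fubini[OF f(3) iv] by (simp add: moment_def mult.commute)
    have ih2: "integrable unit_interval (\<lambda>t. (h t)\<^sup>2)" using L2_imp_integrable[OF hL2] by simp
    \<comment> \<open>Completion of the square, with the cross term evaluated by B h =
      -\<open>moment k\<close>. After integration this cross term cancels against the linear part of
      R by \<open>F\<close>.\<close>
    have point: "B t * (v t)\<^sup>2 = B t * (g t)\<^sup>2 - B t * (h t)\<^sup>2 - 2 * (moment k t * v t)" for t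
    proof -
      have "B t * (v t)\<^sup>2 = B t * (\<bar>g t\<bar>)\<^sup>2 - B t * (h t)\<^sup>2 + 2 * (B t * h t) * v t"
        unfolding v_def by (simp only: power2_eq_square) (simp add: algebra_simps)
      then show ?thesis by (simp add: Bh)
    qed
    have iBv: "integrable unit_interval (\<lambda>t. B t * (v t)\<^sup>2)"
      unfolding point using iB[OF ig(2)] iB[OF ih2] ip by simp
    have "(LINT t|unit_interval. B t * (v t)\<^sup>2) = (LINT t|unit_interval. B t * (g t)\<^sup>2)
        - (LINT t|unit_interval. B t * (h t)\<^sup>2) - 2 * (LINT t|unit_interval. moment k t * v t)"
      unfolding point using iB[OF ig(2)] iB[OF ih2] ip by simp
    moreover have "(LINT t|unit_interval. R t) = (LINT t|unit_interval. (1 - t) * sin (K t))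
        - (LINT t|unit_interval. (1 - t) * sin (k t)) + (LINT t|unit_interval. ?f t * prim v t)"
      unfolding R_def right_diff_distrib using isin[OF Km] isin[OF km] ifv by simp
    ultimately have D: "energy B K - energy B ?k =
        1/2 * (LINT t|unit_interval. B t * (v t)\<^sup>2) + (LINT t|unit_interval. R t)"
      unfolding Ek F by (simp add: energy_def g_def algebra_simps)
    have nn1: "0 \<le> (LINT t|unit_interval. B t * (v t)\<^sup>2)"
      by (rule Bochner_Integration.integral_nonneg) (rule mult_nonneg_nonneg[OF less_imp_le[OF Bpos] zero_le_power2])
    have nn2: "0 \<le> (LINT t|unit_interval. R t)"
      by (rule Bochner_Integration.integral_nonneg) (use Rnn in auto)
    have "K = ?k" if E: "energy B K = energy B ?k"
    proof -
      have "(LINT t|unit_interval. B t * (v t)\<^sup>2) = 0" and R0: "(LINT t|unit_interval. R t) = 0"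
        using D E nn1 nn2 by auto
      then have "AE t in unit_interval. B t * (v t)\<^sup>2 = 0"
        by (subst integral_nonneg_eq_0_iff_AE[OF iBv, symmetric])
           (use mult_nonneg_nonneg[OF less_imp_le[OF Bpos] zero_le_power2] in \<open>auto\<close>)
      then have "AE t in unit_interval. v t = 0"
        by eventually_elim (use Bpos in \<open>auto simp: less_le\<close>)
      then have pv0: "prim v t = 0" for t
        using prim_cong_AE[of v "\<lambda>_. 0" t] by (simp add: prim_def)
      have "AE t in unit_interval. R t = 0"
        using R0 by (subst integral_nonneg_eq_0_iff_AE[OF iR, symmetric]) (use Rnn in auto)
      moreover have "AE t in unit_interval. t \<in> {0<..<1}"
        by (rule AE_I2) simp
      ultimately have "AE t in unit_interval. K t = ?k t"
      proof eventually_elim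
        fix t :: real assume R: "R t = 0" and t: "t \<in> {0<..<1}"
        have "n t = - k t" using pv[of t] pv0[of t] t by auto
        moreover have "\<bar>K t\<bar> \<le> n t" unfolding n_def using Kg[of t] t abs_prim_le[of g t] by simp
        ultimately have "\<bar>K t\<bar> \<le> pi/2" using range[of t] t by auto
        moreover have "sin (K t) = sin (k t)" using R t by (simp add: R_def pv0)
        ultimately have "K t = k t"
          using range[of t] t sin_inj_pi[of "K t" "k t"] by (auto simp: abs_le_iff)
        then show "K t = ?k t" using t by simp
      qed
      moreover have "continuous_on {0..1} ?k" using W(1) by (simp add: W12_l_def W12_def)
      ultimately have "K t = ?k t" if "t \<in> {0..1}" for t
        using continuous_AE_eq[OF Kc] that by blast
      moreover have "K \<in> extensional {0..1}" using K by (simp add: W12_l_def W12_def)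
      ultimately show ?thesis
        by (intro extensionalityI[of K "{0..1}"]) auto
    qed
    with D nn1 nn2 show ?thesis by auto
  qed
  show ?thesis
    unfolding state_def
  proof (rule the_equality)
    show "is_arg_min (energy B) (\<lambda>K. K \<in> W12_l) ?k"
      using W(1) main by (auto simp: is_arg_min_def not_less)
    show "K = ?k" if "is_arg_min (energy B) (\<lambda>K. K \<in> W12_l) K" for K
      using that W(1) main[of K] by (auto simp: is_arg_min_def not_less)
  qed
qed

section \<open>Solvability of the state equation\<close>

lemma LINT_tendsto_bounded:
  fixes f :: "nat \<Rightarrow> real \<Rightarrow> real"
  assumes "\<And>n. f n \<in> borel_measurable unit_interval" "g \<in> borel_measurable unit_interval"
    and "\<And>n t. 0 < t \<Longrightarrow> t < 1 \<Longrightarrow> \<bar>f n t\<bar> \<le> C"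
    and "AE t in unit_interval. (\<lambda>n. f n t) \<longlonglongrightarrow> g t"
  shows "(\<lambda>n. LINT t|unit_interval. f n t) \<longlonglongrightarrow> (LINT t|unit_interval. g t)"
  by (rule integral_dominated_convergence[where w = "\<lambda>_. C"]) (use assms in auto)

lemma prim_tendsto_bounded:
  fixes f :: "nat \<Rightarrow> real \<Rightarrow> real"
  assumes m[measurable]: "\<And>n. f n \<in> borel_measurable unit_interval" "g \<in> borel_measurable unit_interval"
    and b: "\<And>n t. 0 < t \<Longrightarrow> t < 1 \<Longrightarrow> \<bar>f n t\<bar> \<le> C"
    and ae: "AE t in unit_interval. (\<lambda>n. f n t) \<longlonglongrightarrow> g t"
  shows "(\<lambda>n. prim (f n) x) \<longlonglongrightarrow> prim g x"
  unfolding prim_def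
proof (rule LINT_tendsto_bounded[where C = C])
  show "\<bar>indicator {..x} t * f n t\<bar> \<le> C" if "0 < t" "t < 1" for n t
    using b[OF that, of n] by (auto simp: indicator_def)
  show "AE t in unit_interval. (\<lambda>n. indicator {..x} t * f n t) \<longlonglongrightarrow> indicator {..x} t * g t"
    using ae by eventually_elim (rule tendsto_mult_left)
qed measurable

lemma Arzela_Ascoli_lipschitz:
  fixes f :: "nat \<Rightarrow> real \<Rightarrow> real"
  assumes b: "\<And>n t. t \<in> {0..1} \<Longrightarrow> \<bar>f n t\<bar> \<le> M" and L: "0 < L"
    and lip: "\<And>n s t. s \<in> {0..1} \<Longrightarrow> t \<in> {0..1} \<Longrightarrow> \<bar>f n s - f n t\<bar> \<le> L * \<bar>s - t\<bar>"
  obtains g r where "continuous_on {0..1} g" "strict_mono (r :: nat \<Rightarrow> nat)"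
    "\<And>e. 0 < e \<Longrightarrow> \<exists>N. \<forall>n\<ge>N. \<forall>t\<in>{0..1}. \<bar>f (r n) t - g t\<bar> < e"
    "\<And>t. t \<in> {0..1} \<Longrightarrow> (\<lambda>n. f (r n) t) \<longlonglongrightarrow> g t"
proof (rule Arzela_Ascoli[of "{0..1}" f M])
  show "\<exists>d. 0 < d \<and> (\<forall>n y. y \<in> {0..1} \<and> norm (x - y) < d \<longrightarrow> norm (f n x - f n y) < e)"
    if "x \<in> {0..1}" "0 < e" for x e :: real
  proof (intro exI[of _ "e / L"] conjI allI impI)
    show "0 < e / L" using that L by simp
    fix n y assume y: "y \<in> {0..1} \<and> norm (x - y) < e / L"
    have "norm (f n x - f n y) \<le> L * \<bar>x - y\<bar>" using lip that y by simp
    also have "\<dots> < e" using y L by (simp add: pos_less_divide_eq mult.commute)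
    finally show "norm (f n x - f n y) < e" .
  qed
  fix g and r :: "nat \<Rightarrow> nat"
  assume g: "continuous_on {0..1} g" "strict_mono r"
    and u: "\<And>e. 0 < e \<Longrightarrow> \<exists>N. \<forall>n x. n \<ge> N \<and> x \<in> {0..1} \<longrightarrow> norm (f (r n) x - g x) < e"
  show thesis
  proof (rule that[OF g])
    show u': "\<exists>N. \<forall>n\<ge>N. \<forall>t\<in>{0..1}. \<bar>f (r n) t - g t\<bar> < e" if "0 < e" for e
      using u[OF that] by (auto simp del: atLeastAtMost_iff)
    show "(\<lambda>n. f (r n) t) \<longlonglongrightarrow> g t" if "t \<in> {0..1}" for t
      using u' that unfolding LIMSEQ_iff real_norm_def by meson
  qed
qed (use b in auto)

section \<open>Truncated sine and the variational problem for the moment\<close>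

lemma abs_cos_diff_le: "\<bar>cos z - cos w\<bar> \<le> \<bar>z - w\<bar>" for z w :: real
proof -
  have lt: "\<bar>cos y - cos x\<bar> \<le> \<bar>y - x\<bar>" if xy: "x < y" for x y :: real
  proof -
    obtain t where "cos y - cos x = (y - x) * - sin t"
      using MVT2[OF xy, of cos "\<lambda>t. - sin t"] by auto
    then have "\<bar>cos y - cos x\<bar> = \<bar>y - x\<bar> * \<bar>sin t\<bar>" by (simp add: abs_mult)
    also have "\<dots> \<le> \<bar>y - x\<bar> * 1" by (intro mult_left_mono) auto
    finally show ?thesis by simp
  qed
  show ?thesis
    using lt[of z w] lt[of w z] by (cases z w rule: linorder_cases) (auto simp: abs_minus_commute)
qed

text \<open>Replacing $K$ by $\max(K,-\pi/2)$ in $\sin K$ keeps its derivative nonnegative for all $K \le 0$.\<close>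

lemma frozen_sin_quadratic_bound:
  fixes x y :: real
  assumes "x \<le> 0" "y \<le> 0"
  shows "sin (max y (- (pi/2))) \<le>
    sin (max x (- (pi/2))) + cos (max x (- (pi/2))) * (y - x) + (y - x)\<^sup>2"
proof -
  define u v where "u = max x (- (pi/2))" and "v = max y (- (pi/2))"
  \<comment> \<open>Mean value theorem for either order of u and v. As the cosine is 1-Lipschitz,
    this gives the quadratic remainder with coefficient 1 at the truncated points.\<close>
  have "\<exists>z. \<bar>z - u\<bar> \<le> \<bar>v - u\<bar> \<and> sin v - sin u = (v - u) * cos z"
  proof (cases u v rule: linorder_cases)
    case less
    then show ?thesis using MVT2[OF less, of sin cos] by force
  next
    case greater
    obtain z where "v < z" "z < u" "sin u - sin v = (u - v) * cos z"
      using MVT2[OF greater, of sin cos] by auto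
    then show ?thesis by (intro exI[of _ z]) (auto simp: algebra_simps)
  qed auto
  then obtain z where z: "\<bar>z - u\<bar> \<le> \<bar>v - u\<bar>" "sin v - sin u = (v - u) * cos z" by blast
  have "(v - u) * (cos z - cos u) \<le> \<bar>v - u\<bar> * \<bar>cos z - cos u\<bar>"
    by (simp add: abs_mult[symmetric])
  also have "\<dots> \<le> \<bar>v - u\<bar> * \<bar>v - u\<bar>"
    using abs_cos_diff_le[of z u] z(1) by (intro mult_left_mono) auto
  also have "\<dots> = (v - u)\<^sup>2" by (simp add: power2_eq_square)
  finally have 1: "sin v \<le> sin u + cos u * (v - u) + (v - u)\<^sup>2"
    using z(2) by (simp add: algebra_simps)
  \<comment> \<open>It remains to replace the truncated increment v - u by y - x. For x \<le> -pi/2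
    the slope cos u is 0 and truncation does not enlarge distances; if neither point is truncated,
    nothing changes.\<close>
  have 2: "cos u * (v - u) + (v - u)\<^sup>2 \<le> cos u * (y - x) + (y - x)\<^sup>2"
  proof (cases "x \<le> - (pi/2)")
    case True
    then have u: "u = - (pi/2)" by (simp add: u_def)
    have "\<bar>v - u\<bar> \<le> \<bar>y - x\<bar>" using True by (auto simp: u v_def max_def)
    then have "(v - u)\<^sup>2 \<le> (y - x)\<^sup>2" by (simp add: abs_le_square_iff)
    then show ?thesis by (simp add: u)
  next
    case x: False
    then have u: "u = x" by (simp add: u_def)
    show ?thesis
    proof (cases "- (pi/2) \<le> y")
      case True
      then show ?thesis by (simp add: u v_def)
    next
      case False
      then have v: "v = - (pi/2)" by (simp add: v_def)
      \<comment> \<open>Here y < v = -pi/2 < x. The linear term loses (v - y) cos x with cos x \<le>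
        x - v; the square gains 2 (v - y) (x - v) + (v - y)^2, which covers the loss.\<close>
      have "cos x = sin (x - v)" by (simp add: v sin_add)
      also have "\<dots> \<le> x - v" using x v by (intro sin_x_le_x) simp
      finally have "(v - y) * cos x \<le> (v - y) * (x - v)" using False v by (intro mult_left_mono) auto
      moreover have "0 \<le> (v - y) * (x - v)" using False v x by (intro mult_nonneg_nonneg) auto
      moreover have "0 \<le> (v - y)\<^sup>2" by simp
      ultimately have "(v - y) * cos x \<le> 2 * ((v - y) * (x - v)) + (v - y)\<^sup>2" by linarith
      then show ?thesis by (simp add: u power2_eq_square algebra_simps)
    qed
  qed
  from 1 2 show ?thesis by (simp add: u_def v_def)
qed

text \<open>\<Phi> is the energy with truncated sine, written in p = -B k'. At a minimiser g let q
  be the truncated moment belonging to g. The direction d = q - g is admissible and has first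
  variation -int d^2 / B, so g = q a.e., which is the truncated state equation. A solution of it
  never goes below -pi/2: after reaching that value it would have zero moment and stay constant. So
  the truncation is inactive.\<close>

lemma exists_solution_state_equation:
  assumes B: "B \<in> borel_measurable unit_interval" "\<And>t. a \<le> B t" and a: "0 < a"
  shows "\<exists>k. continuous_on {0..1} k \<and> (\<forall>t\<in>{0..1}. k t = - prim (\<lambda>s. moment k s / B s) t)
    \<and> (\<forall>t\<in>{0..1}. - (pi/2) \<le> k t \<and> k t \<le> 0)"
proof -
  have [measurable]: "B \<in> borel_measurable unit_interval" by (rule B)
  have Bpos: "0 < B t" for t using B(2)[of t] a by simp
  define S where "S = (\<lambda>x::real. sin (max x (- (pi/2))))"
  define c where "c = (\<lambda>x::real. cos (max x (- (pi/2))))"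
  \<comment> \<open>The weight 1 - s and the truncated cosine of a nonpositive function lie in
    [0,1], so truncated moments have values in [0,1] and Lipschitz constant 1. P is chosen to
    contain them; p \<ge> 0 keeps \<open>KK p\<close> nonpositive.\<close>
  define P where "P = {p. (\<forall>t\<in>{0..1}. 0 \<le> p t \<and> p t \<le> (1::real)) \<and>
    (\<forall>s\<in>{0..1}. \<forall>t\<in>{0..1}. \<bar>p s - p t\<bar> \<le> 1 * \<bar>s - t\<bar>)}"
  define KK where "KK = (\<lambda>p t. - prim (\<lambda>s. p s / B s) t)"
  define \<Phi> where "\<Phi> = (\<lambda>p. 1/2 * (LINT t|unit_interval. (p t)\<^sup>2 / B t)
    + (LINT t|unit_interval. (1 - t) * S (KK p t)))"
  have Pc: "continuous_on {0..1} p" if "p \<in> P" for p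
  proof (rule lipschitz_on_continuous_on)
    show "1-lipschitz_on {0..1} p"
      using that by (intro lipschitz_onI) (auto simp: P_def dist_real_def)
  qed
  have iB: "integrable unit_interval (\<lambda>t. f t / B t)" if "continuous_on {0..1} f" for f
  proof -
    have "integrable unit_interval (\<lambda>t. 1 / B t * f t)"
    proof (rule integrable_mult_bounded[OF integrable_unit_interval_continuous[OF that]])
      show "\<bar>1 / B t\<bar> \<le> 1 / a" for t
        using B(2)[of t] a by (simp add: abs_of_pos[OF Bpos] frac_le)
    qed measurable
    then show ?thesis by simp
  qed
  have KKc: "continuous_on A (KK p)" if "continuous_on {0..1} p" for p A
    unfolding KK_def by (intro continuous_intros continuous_on_subset[OF prim_continuous[OF iB[OF that]]]) auto
  have KK0: "KK p t \<le> 0" if "p \<in> P" for p t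
  proof -
    have "0 \<le> prim (\<lambda>s. p s / B s) t"
      by (rule prim_nonneg) (use that Bpos in \<open>auto simp: P_def less_imp_le intro!: divide_nonneg_nonneg\<close>)
    then show ?thesis by (simp add: KK_def)
  qed
  have Sc: "continuous_on A (\<lambda>t. S (f t))" "continuous_on A (\<lambda>t. c (f t))" if "continuous_on A f" for A and f :: "real \<Rightarrow> real"
    unfolding S_def c_def by (intro continuous_intros that)+
  have \<Phi>lb: "-1 \<le> \<Phi> p" if "p \<in> P" for p
  proof -
    have "0 \<le> (LINT t|unit_interval. (p t)\<^sup>2 / B t)"
      by (rule Bochner_Integration.integral_nonneg) (use Bpos in \<open>simp add: less_imp_le\<close>)
    moreover have "\<bar>LINT t|unit_interval. (1 - t) * S (KK p t)\<bar> \<le> 1"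
    proof (rule LINT_abs_le_const)
      show "(\<lambda>t. (1 - t) * S (KK p t)) \<in> borel_measurable unit_interval"
        by (intro continuous_on_imp_measurable_unit_interval continuous_intros Sc KKc Pc that)
    qed (auto simp: abs_mult S_def intro!: mult_le_one)
    ultimately show ?thesis by (simp add: \<Phi>_def)
  qed
  define m where "m = Inf (\<Phi> ` P)"
  have bdd: "bdd_below (\<Phi> ` P)" using \<Phi>lb by (auto intro!: bdd_belowI[of _ "-1"])
  have "(\<lambda>_. 0) \<in> P" by (simp add: P_def)
  then have ne: "\<Phi> ` P \<noteq> {}" by auto
  have "\<exists>p\<in>P. \<Phi> p < m + 1 / real (Suc n)" for n
    using cInf_lessD[OF ne, of "m + 1 / real (Suc n)"] by (auto simp: m_def)
  then obtain p where p: "\<And>n. p n \<in> P" "\<And>n. \<Phi> (p n) < m + 1 / real (Suc n)" by metis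
  obtain g and r :: "nat \<Rightarrow> nat" where g: "continuous_on {0..1} g" and r: "strict_mono r"
    and lim: "\<And>t. t \<in> {0..1} \<Longrightarrow> (\<lambda>n. p (r n) t) \<longlonglongrightarrow> g t"
  proof (rule Arzela_Ascoli_lipschitz[of p 1 1])
    show "\<bar>p n t\<bar> \<le> 1" if "t \<in> {0..1}" for n t using p(1)[of n] that by (auto simp: P_def)
    show "\<bar>p n s - p n t\<bar> \<le> 1 * \<bar>s - t\<bar>" if "s \<in> {0..1}" "t \<in> {0..1}" for n s t
      using p(1)[of n] that unfolding P_def by blast
  qed auto
  have gP: "g \<in> P"
    unfolding P_def
  proof (intro CollectI conjI ballI)
    fix t :: real assume t: "t \<in> {0..1}"
    show "0 \<le> g t" by (rule LIMSEQ_le_const[OF lim[OF t]]) (use p(1) t in \<open>auto simp: P_def\<close>)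
    show "g t \<le> 1" by (rule LIMSEQ_le_const2[OF lim[OF t]]) (use p(1) t in \<open>auto simp: P_def\<close>)
    fix s :: real assume s: "s \<in> {0..1}"
    have "(\<lambda>n. \<bar>p (r n) t - p (r n) s\<bar>) \<longlonglongrightarrow> \<bar>g t - g s\<bar>"
      by (intro tendsto_intros lim s t)
    moreover have "\<bar>p (r n) t - p (r n) s\<bar> \<le> 1 * \<bar>t - s\<bar>" for n
      using p(1)[of "r n"] s t unfolding P_def by blast
    ultimately show "\<bar>g t - g s\<bar> \<le> 1 * \<bar>t - s\<bar>" by (intro LIMSEQ_le_const2) auto
  qed
  have Pm: "q \<in> borel_measurable unit_interval" if "q \<in> P" for q
    by (rule continuous_on_imp_measurable_unit_interval[OF Pc[OF that]])
  note [measurable] = Pm[OF gP] Pm[OF p(1)]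
  have div_le: "\<bar>x / B t\<bar> \<le> 1 / a" if "\<bar>x\<bar> \<le> 1" for x t
    using that B(2)[of t] a by (auto simp: abs_div abs_of_pos[OF Bpos] intro!: frac_le)
  have limae: "AE t in unit_interval. (\<lambda>n. p (r n) t) \<longlonglongrightarrow> g t"
    by (rule AE_I2) (use lim in auto)
  have "(\<lambda>n. \<Phi> (p (r n))) \<longlonglongrightarrow> \<Phi> g"
    unfolding \<Phi>_def
  proof (intro tendsto_add tendsto_mult_left LINT_tendsto_bounded)
    show "\<bar>(p (r n) t)\<^sup>2 / B t\<bar> \<le> 1 / a" if "0 < t" "t < 1" for n t
      using p(1)[of "r n"] that by (intro div_le) (auto simp: P_def power_le_one)
    show "AE t in unit_interval. (\<lambda>n. (p (r n) t)\<^sup>2 / B t) \<longlonglongrightarrow> (g t)\<^sup>2 / B t"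
      using limae by eventually_elim (use Bpos in \<open>auto intro!: tendsto_intros simp: less_imp_neq[THEN not_sym]\<close>)
    show "\<bar>(1 - t) * S (KK (p (r n)) t)\<bar> \<le> 1" if "0 < t" "t < 1" for n t
      using that by (auto simp: abs_mult S_def intro!: mult_le_one)
    have K: "(\<lambda>n. KK (p (r n)) t) \<longlonglongrightarrow> KK g t" for t
      unfolding KK_def
    proof (intro tendsto_minus prim_tendsto_bounded[where C = "1 / a"])
      show "\<bar>p (r n) t / B t\<bar> \<le> 1 / a" if "0 < t" "t < 1" for n t
        using p(1)[of "r n"] that by (intro div_le) (auto simp: P_def)
      show "AE t in unit_interval. (\<lambda>n. p (r n) t / B t) \<longlonglongrightarrow> g t / B t"
        using limae by eventually_elim (use Bpos in \<open>auto intro!: tendsto_intros simp: less_imp_neq[THEN not_sym]\<close>)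
    qed measurable
    show "AE t in unit_interval. (\<lambda>n. (1 - t) * S (KK (p (r n)) t)) \<longlonglongrightarrow> (1 - t) * S (KK g t)"
      unfolding S_def by (rule AE_I2) (intro tendsto_intros K)
    have "(\<lambda>t. (1 - t) * S (KK q t)) \<in> borel_measurable unit_interval" if "q = g \<or> q = p (r n)" for q n
      by (intro continuous_on_imp_measurable_unit_interval continuous_intros Sc KKc Pc) (use that gP p(1) in auto)
    then show "(\<lambda>t. (1 - t) * S (KK (p (r n)) t)) \<in> borel_measurable unit_interval"
      "(\<lambda>t. (1 - t) * S (KK g t)) \<in> borel_measurable unit_interval" for n by blast+
  qed measurable
  moreover have "(\<lambda>n. m + 1 / real (Suc n)) \<longlonglongrightarrow> m + 0"
    by (intro tendsto_intros LIMSEQ_Suc[OF lim_1_over_n])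
  moreover have "\<Phi> (p (r n)) \<le> m + 1 / real (Suc n)" for n
  proof -
    have "n \<le> r n" by (rule seq_suble[OF r])
    then have "1 / real (Suc (r n)) \<le> 1 / real (Suc n)" by (simp add: frac_le)
    with p(2)[of "r n"] show ?thesis by linarith
  qed
  ultimately have "\<Phi> g \<le> m" by (intro LIMSEQ_le[of _ "\<Phi> g" _ m]) auto
  then have min: "\<Phi> g \<le> \<Phi> q" if "q \<in> P" for q
    using cInf_lower[OF imageI[OF that] bdd] unfolding m_def by linarith
  define k where "k = KK g"
  have kc: "continuous_on A k" for A unfolding k_def by (rule KKc[OF g])
  have k0: "k t \<le> 0" for t unfolding k_def by (rule KK0[OF gP])
  define f where "f = (\<lambda>s. (1 - s) * c (k s))"
  have fc: "continuous_on A f" for A unfolding f_def by (intro continuous_intros Sc kc)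
  have if': "integrable unit_interval f" by (rule integrable_unit_interval_continuous[OF fc])
  have cb: "0 \<le> c (k s)" "c (k s) \<le> 1" for s
    using order_trans[OF k0[of s] pi_half_ge_zero] by (auto simp: c_def intro!: cos_ge_zero max.boundedI)
  have fb: "0 \<le> f s" "f s \<le> 1" if "0 < s" "s < 1" for s
    unfolding f_def using that cb[of s] by (auto intro!: mult_le_one)
  define q where "q = tail f"
  have qnn: "0 \<le> q t" for t
    unfolding q_def tail_eq[OF if']
    by (rule Bochner_Integration.integral_nonneg) (use fb in auto)
  have fm: "f \<in> borel_measurable unit_interval" by (rule continuous_on_imp_measurable_unit_interval[OF fc])
  have fab: "\<bar>f s\<bar> \<le> 1" if "0 < s" "s < 1" for s using fb[OF that] by simp
  have qP: "q \<in> P"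
    unfolding P_def
  proof (intro CollectI conjI ballI)
    fix t :: real assume t: "t \<in> {0..1}"
    show "0 \<le> q t" by (rule qnn)
    show "q t \<le> 1" using abs_tail_le[OF fm fab t] by (simp add: q_def)
    fix s :: real assume s: "s \<in> {0..1}"
    show "\<bar>q t - q s\<bar> \<le> 1 * \<bar>t - s\<bar>"
      unfolding q_def by (rule tail_lipschitz[OF fm fab s t])
  qed
  define d where "d = (\<lambda>t. q t - g t)"
  have dc: "continuous_on {0..1} d" unfolding d_def by (intro continuous_intros Pc qP g)
  define D where "D = prim (\<lambda>t. d t / B t)"
  have Dc: "continuous_on A D" for A
    unfolding D_def by (rule continuous_on_subset[OF prim_continuous[OF iB[OF dc]]]) simp
  define E where "E = (LINT t|unit_interval. (d t)\<^sup>2 / B t)"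
  define C where "C = 1/2 * E + (LINT t|unit_interval. (1 - t) * (D t)\<^sup>2)"
  have ic: "integrable unit_interval u" if "continuous_on {0..1} u" for u :: "real \<Rightarrow> real"
    by (rule integrable_unit_interval_continuous[OF that])
  \<comment> \<open>First variation along d. The quadratic term contributes \<epsilon> int g d / B,
    the sine term -\<epsilon> int f D = -\<epsilon> int q d / B by \<open>prim_Fubini\<close>; the
    sum is -\<epsilon> E. The remainder is at most \<epsilon>^2 C by
    \<open>frozen_sin_quadratic_bound\<close>. Minimality of g and division by \<epsilon> give the
    claim.\<close>
  have EC: "E \<le> \<epsilon> * C" if \<epsilon>: "0 < \<epsilon>" "\<epsilon> \<le> 1" for \<epsilon>
  proof -
    let ?w = "\<lambda>t. g t + \<epsilon> * d t"
    have w: "?w t = (1 - \<epsilon>) * g t + \<epsilon> * q t" for t by (simp add: d_def algebra_simps)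
    have wP: "?w \<in> P"
      unfolding P_def
    proof (intro CollectI conjI ballI)
      fix t :: real assume t: "t \<in> {0..1}"
      have gt: "0 \<le> g t" "g t \<le> 1" and qt: "0 \<le> q t" "q t \<le> 1" using gP qP t by (auto simp: P_def)
      show "0 \<le> ?w t" unfolding w using gt qt \<epsilon> by simp
      show "?w t \<le> 1" unfolding w by (rule convex_bound_le) (use gt qt \<epsilon> in auto)
      fix s :: real assume s: "s \<in> {0..1}"
      have gl: "\<bar>g t - g s\<bar> \<le> \<bar>t - s\<bar>" using gP s t unfolding P_def by fastforce
      have ql: "\<bar>q t - q s\<bar> \<le> \<bar>t - s\<bar>" using qP s t unfolding P_def by fastforce
      have "\<bar>?w t - ?w s\<bar> = \<bar>(1 - \<epsilon>) * (g t - g s) + \<epsilon> * (q t - q s)\<bar>"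
        unfolding w by (simp add: algebra_simps)
      also have "\<dots> \<le> (1 - \<epsilon>) * \<bar>g t - g s\<bar> + \<epsilon> * \<bar>q t - q s\<bar>"
        using \<epsilon> by (intro order_trans[OF abs_triangle_ineq]) (simp add: abs_mult)
      also have "\<dots> \<le> \<bar>t - s\<bar>"
        by (rule convex_bound_le) (use gl ql \<epsilon> in auto)
      finally show "\<bar>?w t - ?w s\<bar> \<le> 1 * \<bar>t - s\<bar>" by simp
    qed
    have KKw: "KK ?w t = k t - \<epsilon> * D t" for t
    proof -
      have "prim (\<lambda>s. ?w s / B s) t = prim (\<lambda>s. g s / B s + \<epsilon> * (d s / B s)) t"
        by (simp add: add_divide_distrib)
      also have "\<dots> = prim (\<lambda>s. g s / B s) t + \<epsilon> * D t"
        unfolding D_def by (subst prim_add) (use iB[OF g] iB[OF dc] in \<open>auto simp only: prim_cmult integrable_mult_right\<close>)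
      finally show ?thesis by (simp add: KK_def k_def)
    qed
    have i1: "integrable unit_interval (\<lambda>t. (g t)\<^sup>2 / B t)"
      "integrable unit_interval (\<lambda>t. g t * d t / B t)"
      "integrable unit_interval (\<lambda>t. (d t)\<^sup>2 / B t)"
      "integrable unit_interval (\<lambda>t. q t * d t / B t)"
      by (intro iB continuous_intros g dc Pc qP)+
    have quad: "(LINT t|unit_interval. (?w t)\<^sup>2 / B t) = (LINT t|unit_interval. (g t)\<^sup>2 / B t)
      + 2 * \<epsilon> * (LINT t|unit_interval. g t * d t / B t) + \<epsilon>\<^sup>2 * E"
    proof -
      have "(LINT t|unit_interval. (?w t)\<^sup>2 / B t) =
        (LINT t|unit_interval. (g t)\<^sup>2 / B t + 2 * \<epsilon> * (g t * d t / B t) + \<epsilon>\<^sup>2 * ((d t)\<^sup>2 / B t))"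
        using Bpos[THEN less_imp_neq] by (intro Bochner_Integration.integral_cong) (auto simp: power2_eq_square field_simps)
      also have "\<dots> = (LINT t|unit_interval. (g t)\<^sup>2 / B t) + (LINT t|unit_interval. 2 * \<epsilon> * (g t * d t / B t))
         + (LINT t|unit_interval. \<epsilon>\<^sup>2 * ((d t)\<^sup>2 / B t))"
        using i1 by (simp only: Bochner_Integration.integral_add Bochner_Integration.integrable_add integrable_mult_right)
      finally show ?thesis by (simp only: E_def integral_mult_right_zero)
    qed
    have i2: "integrable unit_interval (\<lambda>t. (1 - t) * S (k t))"
      "integrable unit_interval (\<lambda>t. f t * D t)"
      "integrable unit_interval (\<lambda>t. (1 - t) * (D t)\<^sup>2)"
      "integrable unit_interval (\<lambda>t. (1 - t) * S (KK ?w t))"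
      by (intro ic continuous_intros Sc kc fc Dc KKc Pc[OF wP])+
    have "(LINT t|unit_interval. (1 - t) * S (KK ?w t)) \<le>
      (LINT t|unit_interval. (1 - t) * S (k t) + (- \<epsilon>) * (f t * D t) + \<epsilon>\<^sup>2 * ((1 - t) * (D t)\<^sup>2))"
    proof (rule integral_mono)
      show "integrable unit_interval (\<lambda>t. (1 - t) * S (k t) + (- \<epsilon>) * (f t * D t) + \<epsilon>\<^sup>2 * ((1 - t) * (D t)\<^sup>2))"
        using i2 by (intro Bochner_Integration.integrable_add integrable_mult_right)
      fix t assume "t \<in> space unit_interval"
      then have t: "0 < t" "t < 1" by auto
      have "S (KK ?w t) \<le> S (k t) + c (k t) * (KK ?w t - k t) + (KK ?w t - k t)\<^sup>2"
        unfolding S_def c_def by (rule frozen_sin_quadratic_bound[OF k0 KK0[OF wP]])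
      then have "S (KK ?w t) \<le> S (k t) - \<epsilon> * (c (k t) * D t) + \<epsilon>\<^sup>2 * (D t)\<^sup>2"
        by (simp add: KKw power_mult_distrib mult_ac)
      then have "(1 - t) * S (KK ?w t) \<le> (1 - t) * (S (k t) - \<epsilon> * (c (k t) * D t) + \<epsilon>\<^sup>2 * (D t)\<^sup>2)"
        using t by (intro mult_left_mono) auto
      then show "(1 - t) * S (KK ?w t) \<le> (1 - t) * S (k t) + (- \<epsilon>) * (f t * D t) + \<epsilon>\<^sup>2 * ((1 - t) * (D t)\<^sup>2)"
        by (simp add: f_def algebra_simps)
    qed (rule i2)
    also have "\<dots> = (LINT t|unit_interval. (1 - t) * S (k t)) + (- \<epsilon>) * (LINT t|unit_interval. f t * D t)
        + \<epsilon>\<^sup>2 * (LINT t|unit_interval. (1 - t) * (D t)\<^sup>2)"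
      using i2(1-3) by (simp only: Bochner_Integration.integral_add Bochner_Integration.integrable_add integrable_mult_right integral_mult_right_zero)
    also have "(LINT t|unit_interval. f t * D t) = (LINT t|unit_interval. q t * d t / B t)"
      using prim_Fubini[OF if' iB[OF dc]] by (simp add: D_def q_def mult.commute)
    finally have "\<Phi> ?w \<le> \<Phi> g + \<epsilon> * ((LINT t|unit_interval. g t * d t / B t) - (LINT t|unit_interval. q t * d t / B t)) + \<epsilon>\<^sup>2 * C"
      unfolding \<Phi>_def quad C_def k_def by (simp add: algebra_simps)
    also have "(LINT t|unit_interval. g t * d t / B t) - (LINT t|unit_interval. q t * d t / B t) = - E"
    proof -
      have "(LINT t|unit_interval. g t * d t / B t) - (LINT t|unit_interval. q t * d t / B t) =
        (LINT t|unit_interval. g t * d t / B t - q t * d t / B t)"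
        using i1 by simp
      also have "\<dots> = (LINT t|unit_interval. - ((d t)\<^sup>2 / B t))"
        using Bpos[THEN less_imp_neq]
        by (intro Bochner_Integration.integral_cong) (auto simp: d_def power2_eq_square field_simps)
      finally show ?thesis by (simp add: E_def)
    qed
    finally have "\<epsilon> * E \<le> \<epsilon> * (\<epsilon> * C)" using min[OF wP] by (simp add: power2_eq_square)
    then show ?thesis using \<epsilon>(1) by simp
  qed
  have "E \<le> 0"
  proof (rule ccontr)
    assume "\<not> E \<le> 0"
    then have E: "0 < E" by simp
    with EC[of 1] have C: "0 < C" by simp
    \<comment> \<open>The second argument of the minimum makes \<epsilon> C at most E / 2.\<close>
    have "E \<le> min 1 (E / (2 * C)) * C" by (rule EC) (use E C in auto)
    also have "\<dots> \<le> E / (2 * C) * C" using C by (intro mult_right_mono) auto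
    also have "\<dots> = E / 2" using C by simp
    finally show False using E by simp
  qed
  moreover have "0 \<le> E"
    unfolding E_def by (rule Bochner_Integration.integral_nonneg) (use Bpos in \<open>simp add: less_imp_le\<close>)
  ultimately have "E = 0" by simp
  moreover have "integrable unit_interval (\<lambda>t. (d t)\<^sup>2 / B t)" by (intro iB continuous_intros dc)
  ultimately have "AE t in unit_interval. (d t)\<^sup>2 / B t = 0"
    unfolding E_def using Bpos
    by (subst (asm) integral_nonneg_eq_0_iff_AE) (auto simp: less_imp_le)
  then have gq: "AE t in unit_interval. g t / B t = q t / B t"
    by eventually_elim (use Bpos in \<open>auto simp: d_def less_imp_neq[THEN not_sym]\<close>)
  have keq: "k t = - prim (\<lambda>s. q s / B s) t" for t
    unfolding k_def KK_def using prim_cong_AE[OF gq, of t] Pm[OF qP] by simp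
  have iq: "integrable unit_interval (\<lambda>s. q s / B s)" by (rule iB[OF Pc[OF qP]])
  have lower: "- (pi/2) \<le> k t1" if t1: "t1 \<in> {0..1}" for t1
  proof (rule ccontr)
    assume neg: "\<not> - (pi/2) \<le> k t1"
    have "k 0 = 0" by (simp add: keq prim_0)
    then have "\<exists>t0\<ge>0. t0 \<le> t1 \<and> k t0 = - (pi/2)"
      using neg t1 by (intro IVT2') (auto intro: kc)
    then obtain t0 where t0: "0 \<le> t0" "t0 \<le> t1" "k t0 = - (pi/2)" by blast
    \<comment> \<open>k is nonincreasing because q \<ge> 0, so from t0 on the truncated cosine is
      cos(-pi/2) = 0. Since q integrates only to the right of its argument, it vanishes there
      too.\<close>
    have "c (k s) = 0" if "t0 \<le> s" for s
    proof -
      have "k s \<le> k t0"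
        unfolding keq using prim_mono_arg[OF iq _ that] qnn Bpos by (simp add: less_imp_le)
      then show ?thesis using t0(3) by (simp add: c_def)
    qed
    then have q0: "q s = 0" if "t0 \<le> s" for s
      unfolding q_def tail_eq[OF if']
      using that by (intro integral_eq_zero_AE AE_I2) (auto simp: indicator_def f_def)
    have "prim (\<lambda>s. q s / B s) t1 - prim (\<lambda>s. q s / B s) t0 = 0"
      unfolding prim_increment[OF iq t0(2)]
      using q0 by (intro integral_eq_zero_AE AE_I2) (auto simp: indicator_def)
    then have "k t1 = k t0" by (simp add: keq)
    with neg t0(3) show False by simp
  qed
  have "moment k t = q t" for t
  proof -
    have "f s = (1 - s) * cos (k s)" if "0 < s" "s < 1" for s
      using lower[of s] that by (simp add: f_def c_def max_def)
    then have 1: "(LINT s|unit_interval. f s) = (LINT s|unit_interval. (1 - s) * cos (k s))"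
      "prim f t = prim (\<lambda>s. (1 - s) * cos (k s)) t"
      unfolding prim_def by (auto intro!: Bochner_Integration.integral_cong)
    then show ?thesis by (simp add: moment_def q_def tail_def)
  qed
  then have "k t = - prim (\<lambda>s. moment k s / B s) t" for t using keq by simp
  with kc lower k0 show ?thesis by blast
qed

section \<open>Limits of coefficients\<close>

text \<open>The elements of almost minimal $L^2$ norm in decreasing convex sets form a Cauchy sequence, by the
  parallelogram law. This replaces weak compactness together with Mazur's lemma.\<close>

lemma nested_convex_AE_convergent:
  fixes C :: "nat \<Rightarrow> (real \<Rightarrow> real) set"
  assumes ne: "\<And>n. C n \<noteq> {}" and dec: "decseq C"
    and mid: "\<And>n f g. f \<in> C n \<Longrightarrow> g \<in> C n \<Longrightarrow> (\<lambda>t. (f t + g t) / 2) \<in> C n"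
    and meas: "\<And>n f. f \<in> C n \<Longrightarrow> f \<in> borel_measurable unit_interval"
    and bnd: "\<And>n f t. f \<in> C n \<Longrightarrow> \<bar>f t\<bar> \<le> c"
  obtains f g where "\<And>n. f n \<in> C n" "g \<in> borel_measurable unit_interval"
    "AE t in unit_interval. (\<lambda>n. f n t) \<longlonglongrightarrow> g t"
proof -
  define N where "N = (\<lambda>f::real \<Rightarrow> real. LINT t|unit_interval. (f t)\<^sup>2)"
  have isq: "integrable unit_interval (\<lambda>t. (f t)\<^sup>2)" if "f \<in> C n" for f n
    by (rule L2_imp_integrable(2)[OF L2_bounded[OF meas[OF that]]]) (rule bnd[OF that])
  have N0: "0 \<le> N f" for f unfolding N_def by simp
  have Nc: "N f \<le> c\<^sup>2" if "f \<in> C n" for f n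
  proof -
    have "\<bar>N f\<bar> \<le> c\<^sup>2" unfolding N_def
    proof (rule LINT_abs_le_const)
      show "(\<lambda>t. (f t)\<^sup>2) \<in> borel_measurable unit_interval" using isq[OF that] by auto
      show "\<bar>(f t)\<^sup>2\<bar> \<le> c\<^sup>2" for t using bnd[OF that, of t] by (simp add: abs_le_square_iff[symmetric])
    qed
    then show ?thesis by simp
  qed
  define d where "d = (\<lambda>n. Inf (N ` C n))"
  have bdd: "bdd_below (N ` C n)" for n using N0 by (auto intro!: bdd_belowI[of _ 0])
  have dle: "d n \<le> N f" if "f \<in> C n" for n f
    unfolding d_def using bdd that by (intro cInf_lower) auto
  have "incseq d"
    unfolding d_def using ne bdd dec
    by (intro incseq_SucI cInf_superset_mono image_mono) (auto simp: decseq_Suc_iff)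
  moreover have "d n \<le> c\<^sup>2" for n using ne[of n] dle Nc by (metis all_not_in_conv order_trans)
  ultimately obtain L where L: "d \<longlonglongrightarrow> L" using incseq_convergent by blast
  have dL: "d n \<le> L" for n by (rule incseq_le[OF \<open>incseq d\<close> L])
  have "\<exists>f\<in>C n. N f < d n + 1 / real (Suc n)" for n
    using cInf_lessD[of "N ` C n" "d n + 1 / real (Suc n)"] ne by (auto simp: d_def)
  then obtain f where f: "\<And>n. f n \<in> C n" "\<And>n. N (f n) < d n + 1 / real (Suc n)" by metis
  have fC: "f m \<in> C n" if "n \<le> m" for n m using f(1)[of m] decseqD[OF dec that] by auto
  have i1: "integrable unit_interval (f n)" for n
    by (rule integrable_unit_interval_bounded[OF meas[OF f(1)]]) (rule bnd[OF f(1)])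
  \<comment> \<open>Parallelogram law: int (f n - f m)^2 = 2 N(f n) + 2 N(f m) - 4 N(midpoint). For
    n \<le> m the midpoint lies in C n, so its N is at least d n, while N(f n) and N(f m) exceed d n
    and d m by at most 1 / (n + 1). Young's inequality x \<le> e/2 + x^2 / (2e) then passes to the
    L^1 distance, which the subsequence argument uses.\<close>
  have key: "(LINT t|unit_interval. \<bar>f n t - f m t\<bar>) \<le> e / 2 + (2 * (L - d n) + 4 / real (Suc n)) / (2 * e)"
    if nm: "n \<le> m" and e: "0 < e" for n m e
  proof -
    let ?a = "\<lambda>t. (f n t + f m t) / 2"
    have a: "?a \<in> C n" by (rule mid[OF f(1) fC[OF nm]])
    have isd: "integrable unit_interval (\<lambda>t. (f n t - f m t)\<^sup>2)"
    proof -
      have "(\<lambda>t. (f n t - f m t)\<^sup>2) = (\<lambda>t. 2 * (f n t)\<^sup>2 + 2 * (f m t)\<^sup>2 - 4 * (?a t)\<^sup>2)"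
        by (auto simp: fun_eq_iff power2_eq_square field_simps)
      then show ?thesis using isq[OF a] isq[OF f(1)] by (simp only:) auto
    qed
    have "(LINT t|unit_interval. (f n t - f m t)\<^sup>2) = (LINT t|unit_interval. 2 * (f n t)\<^sup>2 + 2 * (f m t)\<^sup>2 - 4 * (?a t)\<^sup>2)"
      by (rule Bochner_Integration.integral_cong) (auto simp: power2_eq_square field_simps)
    also have "\<dots> = 2 * N (f n) + 2 * N (f m) - 4 * N ?a"
      unfolding N_def using isq[OF a] isq[OF f(1)] by simp
    also have "\<dots> \<le> 2 * (L - d n) + 4 / real (Suc n)"
    proof -
      have "1 / real (Suc m) \<le> 1 / real (Suc n)" using nm by (simp add: frac_le)
      with f(2)[of n] f(2)[of m] dle[OF a] dL[of m] show ?thesis by simp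
    qed
    finally have sq: "(LINT t|unit_interval. (f n t - f m t)\<^sup>2) \<le> 2 * (L - d n) + 4 / real (Suc n)" .
    have "(LINT t|unit_interval. \<bar>f n t - f m t\<bar>) \<le> (LINT t|unit_interval. e / 2 + (f n t - f m t)\<^sup>2 / (2 * e))"
    proof (rule integral_mono)
      fix t
      have "0 \<le> (\<bar>f n t - f m t\<bar> - e)\<^sup>2" by simp
      then have "2 * e * \<bar>f n t - f m t\<bar> \<le> e\<^sup>2 + (f n t - f m t)\<^sup>2"
        by (simp add: power2_diff[of "\<bar>f n t - f m t\<bar>"] mult_ac)
      then show "\<bar>f n t - f m t\<bar> \<le> e / 2 + (f n t - f m t)\<^sup>2 / (2 * e)"
        using e by (simp add: field_simps power2_eq_square)
    qed (use i1 isd in auto)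
    also have "\<dots> = e / 2 + (LINT t|unit_interval. (f n t - f m t)\<^sup>2) / (2 * e)"
      using isd by (simp add: measure_unit_interval)
    also have "\<dots> \<le> e / 2 + (2 * (L - d n) + 4 / real (Suc n)) / (2 * e)"
      using sq e by (intro add_left_mono divide_right_mono) auto
    finally show ?thesis .
  qed
  have cauchy: "\<exists>K. \<forall>i\<ge>K. \<forall>j\<ge>K. (LINT t|unit_interval. norm (f i t - f j t)) < e" if e: "0 < e" for e
  proof -
    have "(\<lambda>n. 2 * (L - d n) + 4 * (1 / real (Suc n))) \<longlonglongrightarrow> 2 * (L - L) + 4 * 0"
      by (intro tendsto_intros L LIMSEQ_Suc[OF lim_1_over_n])
    then have "(\<lambda>n. 2 * (L - d n) + 4 / real (Suc n)) \<longlonglongrightarrow> 0" by simp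
    \<comment> \<open>The threshold e^2 makes the second summand of \<open>key\<close> smaller than
      e/2.\<close>
    from order_tendstoD(2)[OF this, of "e\<^sup>2"] e
    obtain K where K: "\<And>n. n \<ge> K \<Longrightarrow> 2 * (L - d n) + 4 / real (Suc n) < e\<^sup>2"
      by (auto simp: eventually_sequentially)
    have lt: "(LINT t|unit_interval. \<bar>f n t - f m t\<bar>) < e" if "K \<le> n" "n \<le> m" for n m
    proof -
      have "(2 * (L - d n) + 4 / real (Suc n)) / (2 * e) < e\<^sup>2 / (2 * e)"
        using K[OF that(1)] e by (intro divide_strict_right_mono) auto
      with key[OF that(2) e] have "(LINT t|unit_interval. \<bar>f n t - f m t\<bar>) < e / 2 + e\<^sup>2 / (2 * e)" by linarith
      also have "\<dots> = e" using e by (simp add: power2_eq_square)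
      finally show ?thesis .
    qed
    have "(LINT t|unit_interval. norm (f i t - f j t)) < e" if "K \<le> i" "K \<le> j" for i j
      using lt[of i j] lt[of j i] that by (cases "i \<le> j") (auto simp: abs_minus_commute)
    then show ?thesis by blast
  qed
  obtain r :: "nat \<Rightarrow> nat" where r: "strict_mono r" "AE t in unit_interval. Cauchy (\<lambda>i. f (r i) t)"
    by (rule cauchy_L1_AE_cauchy_subseq[OF i1 cauchy])
  define g where "g = (\<lambda>t. lim (\<lambda>i. f (r i) t))"
  show thesis
  proof (rule that[of "\<lambda>n. f (r n)" g])
    \<comment> \<open>As r n \<ge> n and the sets decrease, the reindexed sequence still meets the
      n-th condition.\<close>
    show "f (r n) \<in> C n" for n by (rule fC[OF seq_suble[OF r(1)]])
    show "g \<in> borel_measurable unit_interval"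
      unfolding g_def using meas[OF f(1)] by (intro borel_measurable_lim_metric) auto
    show "AE t in unit_interval. (\<lambda>n. f (r n) t) \<longlonglongrightarrow> g t"
      using r(2) by eventually_elim (simp add: g_def Cauchy_convergent_iff convergent_LIMSEQ_iff)
  qed
qed

text \<open>The weight 1 - s is at most 1 and the cosine is 1-Lipschitz. This allows the moments
  along a minimising sequence to be replaced by the moment of the uniform limit of the
  states.\<close>

lemma moment_diff_le:
  assumes k: "continuous_on {0..1} k" and l: "continuous_on {0..1} l"
    and e: "\<And>t. 0 < t \<Longrightarrow> t < 1 \<Longrightarrow> \<bar>k t - l t\<bar> \<le> e" and t: "t \<in> {0..1}"
  shows "\<bar>moment k t - moment l t\<bar> \<le> e"
proof -
  note fk = load_bounds[OF continuous_on_imp_measurable_unit_interval[OF k]]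
  note fl = load_bounds[OF continuous_on_imp_measurable_unit_interval[OF l]]
  let ?h = "\<lambda>s. (1 - s) * cos (k s) - (1 - s) * cos (l s)"
  have e0: "0 \<le> e" using e[of "1/2"] by simp
  have "moment k t - moment l t = tail ?h t"
    using fk(3) fl(3) by (simp add: moment_def tail_def prim_diff)
  also have "\<bar>\<dots>\<bar> \<le> e"
  proof (rule abs_tail_le[OF _ _ t e0])
    show "?h \<in> borel_measurable unit_interval" using fk(1) fl(1) by measurable
    show "\<bar>?h s\<bar> \<le> e" if "0 < s" "s < 1" for s
    proof -
      have "\<bar>?h s\<bar> = \<bar>1 - s\<bar> * \<bar>cos (k s) - cos (l s)\<bar>"
        by (simp add: abs_mult[symmetric] right_diff_distrib)
      also have "\<dots> \<le> 1 * \<bar>k s - l s\<bar>"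
        using that by (intro mult_mono abs_cos_diff_le) auto
      finally show ?thesis using e[OF that] by simp
    qed
  qed
  finally show ?thesis .
qed

text \<open>Reduces to (x - y)^2 \<ge> 0. It keeps the volume constraint, an upper bound for int
  1/f, stable under midpoints.\<close>

lemma inverse_midpoint_le:
  fixes x y :: real
  assumes "0 < x" "0 < y"
  shows "1 / ((x + y) / 2) \<le> (1 / x + 1 / y) / 2"
proof -
  have "0 \<le> (x - y)\<^sup>2" by simp
  then have "4 * (x * y) \<le> (x + y) * (x + y)" by (simp add: power2_eq_square algebra_simps)
  then show ?thesis using assms by (simp add: field_simps)
qed

text \<open>Elements of \<open>Linf_into\<close> obey their bounds only a.e., whereas
  \<open>state_eqI\<close> asks for bounds on B at every point. The energies of a.e. equal
  stiffnesses coincide on \<open>W12_l\<close>, hence so do the definite descriptions.\<close>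

lemma reduced_cost_cong_AE:
  assumes ae: "AE t in unit_interval. \<theta> t = \<eta> t"
    and m: "\<theta> \<in> borel_measurable unit_interval" "\<eta> \<in> borel_measurable unit_interval"
  shows "reduced_cost a b c_l \<theta> = reduced_cost a b c_l \<eta>"
proof -
  note [measurable] = m
  have "energy (stiffness a b \<theta>) K = energy (stiffness a b \<eta>) K" if K: "K \<in> W12_l" for K
  proof -
    have [measurable]: "weak_deriv K \<in> borel_measurable unit_interval"
      using L2_imp_integrable(1)[OF W12_l_weak_deriv(1)[OF K]] by auto
    have "(LINT t|unit_interval. stiffness a b \<theta> t * (weak_deriv K t)\<^sup>2) =
      (LINT t|unit_interval. stiffness a b \<eta> t * (weak_deriv K t)\<^sup>2)"
    proof (rule integral_cong_AE)
      show "AE t in unit_interval. stiffness a b \<theta> t * (weak_deriv K t)\<^sup>2 = stiffness a b \<eta> t * (weak_deriv K t)\<^sup>2"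
        using ae by eventually_elim (simp add: stiffness_def)
    qed (unfold stiffness_def, measurable)
    then show ?thesis by (simp add: energy_def)
  qed
  then have "is_arg_min (energy (stiffness a b \<theta>)) (\<lambda>K. K \<in> W12_l) =
      is_arg_min (energy (stiffness a b \<eta>)) (\<lambda>K. K \<in> W12_l)"
    by (auto simp: is_arg_min_def fun_eq_iff)
  then have "state (stiffness a b \<theta>) = state (stiffness a b \<eta>)"
    by (simp add: state_def)
  moreover have "(LINT t|unit_interval. \<theta> t) = (LINT t|unit_interval. \<eta> t)"
    by (rule integral_cong_AE) (use m ae in auto)
  ultimately show ?thesis by (simp add: reduced_cost_def cost_def)
qed

section \<open>Elementary facts on stiffness and cost\<close>

lemma stiffness_alt: "stiffness a b \<theta> t = a + (b - a) * \<theta> t"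
  by (simp add: stiffness_def algebra_simps)

lemma stiffness_bounds:
  assumes "a \<le> b" "0 \<le> \<theta> t" "\<theta> t \<le> 1"
  shows "a \<le> stiffness a b \<theta> t" "stiffness a b \<theta> t \<le> b"
proof -
  show "a \<le> stiffness a b \<theta> t" using assms by (simp add: stiffness_alt)
  have "(b - a) * \<theta> t \<le> (b - a) * 1" using assms by (intro mult_left_mono) auto
  then show "stiffness a b \<theta> t \<le> b" by (simp add: stiffness_alt)
qed

lemma stiffness_measurable:
  assumes [measurable]: "\<theta> \<in> borel_measurable unit_interval"
  shows "stiffness a b \<theta> \<in> borel_measurable unit_interval"
  unfolding stiffness_def[abs_def] by measurable

lemma reduced_cost_eq:
  assumes "state (stiffness a b \<theta>) = restrict k {0..1}"
  shows "reduced_cost a b c_l \<theta> = - (LINT t|unit_interval. (1 - t) * sin (k t)) + c_l * (LINT t|unit_interval. \<theta> t)"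
proof -
  have "(LINT t|unit_interval. (1 - t) * sin (restrict k {0..1} t)) = (LINT t|unit_interval. (1 - t) * sin (k t))"
    by (rule Bochner_Integration.integral_cong) auto
  then show ?thesis by (simp add: reduced_cost_def cost_def assms)
qed

section \<open>Optimal volume fraction as a limit of relaxed coefficients\<close>

theorem theorem6p1:
  fixes a b c_l :: real
  assumes "0 < a" and "a < b" and "0 < c_l"
  shows "\<exists>\<theta>\<in>Linf_into {0..1}. \<forall>\<eta>\<in>Linf_into {0..1}. reduced_cost a b c_l \<theta> \<le> reduced_cost a b c_l \<eta>"
proof -
  have b: "0 < b" using assms by simp
  \<comment> \<open>Representatives that obey the bounds at every point; a general competitor is
    clamped into this set at the end.\<close>
  define \<Theta> where "\<Theta> = {\<theta> \<in> borel_measurable unit_interval. \<forall>t. 0 \<le> \<theta> t \<and> \<theta> t \<le> (1::real)}"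
  let ?J = "reduced_cost a b c_l"
  have \<Theta>m: "\<theta> \<in> borel_measurable unit_interval" if "\<theta> \<in> \<Theta>" for \<theta> using that by (simp add: \<Theta>_def)
  have \<Theta>i: "integrable unit_interval \<theta>" if "\<theta> \<in> \<Theta>" for \<theta>
    by (rule integrable_unit_interval_bounded[where C = 1]) (use that in \<open>auto simp: \<Theta>_def\<close>)
  have st: "a \<le> stiffness a b \<theta> t" "stiffness a b \<theta> t \<le> b" if "\<theta> \<in> \<Theta>" for \<theta> t
    using stiffness_bounds[of a b \<theta> t] that assms by (auto simp: \<Theta>_def)
  define Q where "Q = (\<lambda>\<theta> k. continuous_on {0..1} k \<and> (\<forall>t\<in>{0..1}. k t = - prim (\<lambda>s. moment k s / stiffness a b \<theta> s) t)
    \<and> (\<forall>t\<in>{0..1}. - (pi/2) \<le> k t \<and> k t \<le> 0))"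
  have "\<forall>\<theta>\<in>\<Theta>. \<exists>k. Q \<theta> k"
    unfolding Q_def
    by (intro ballI exists_solution_state_equation[of _ a] stiffness_measurable \<Theta>m st(1) assms(1))
  from bchoice[OF this] obtain k where k: "\<And>\<theta>. \<theta> \<in> \<Theta> \<Longrightarrow> Q \<theta> (k \<theta>)" by blast
  have kc: "\<And>\<theta>. \<theta> \<in> \<Theta> \<Longrightarrow> continuous_on {0..1} (k \<theta>)"
    and keq: "\<And>\<theta> t. \<theta> \<in> \<Theta> \<Longrightarrow> t \<in> {0..1} \<Longrightarrow> k \<theta> t = - prim (\<lambda>s. moment (k \<theta>) s / stiffness a b \<theta> s) t"
    and kr: "\<And>\<theta> t. \<theta> \<in> \<Theta> \<Longrightarrow> t \<in> {0..1} \<Longrightarrow> - (pi/2) \<le> k \<theta> t \<and> k \<theta> t \<le> 0"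
    using k unfolding Q_def by blast+
  have J: "?J \<theta> = - (LINT t|unit_interval. (1 - t) * sin (k \<theta> t)) + c_l * (LINT t|unit_interval. \<theta> t)" if \<theta>: "\<theta> \<in> \<Theta>" for \<theta>
  proof (rule reduced_cost_eq)
    show "state (stiffness a b \<theta>) = restrict (k \<theta>) {0..1}"
    proof (rule state_eqI[of _ a b])
      show "k \<theta> t = - prim (\<lambda>s. moment (k \<theta>) s / stiffness a b \<theta> s) t" if "t \<in> {0..1}" for t
        by (rule keq[OF \<theta> that])
      show "- (pi / 2) \<le> k \<theta> t \<and> k \<theta> t \<le> 0" if "t \<in> {0..1}" for t
        by (rule kr[OF \<theta> that])
    qed (rule stiffness_measurable \<Theta>m st assms(1) kc \<theta>)+
  qed
  have sinm: "(\<lambda>t. (1 - t) * sin (u t)) \<in> borel_measurable unit_interval" if "continuous_on {0..1} u" for u :: "real \<Rightarrow> real"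
    by (intro continuous_on_imp_measurable_unit_interval continuous_intros that)
  have sinb: "\<bar>(1 - t) * sin x\<bar> \<le> 1" if "0 < t" "t < 1" for t x :: real
    using that by (auto simp: abs_mult intro!: mult_le_one)
  have Jlb: "-1 \<le> ?J \<theta>" if \<theta>: "\<theta> \<in> \<Theta>" for \<theta>
  proof -
    have "0 \<le> (LINT t|unit_interval. \<theta> t)"
      by (rule Bochner_Integration.integral_nonneg) (use \<theta> in \<open>auto simp: \<Theta>_def\<close>)
    then have "0 \<le> c_l * (LINT t|unit_interval. \<theta> t)" using assms by simp
    moreover have "\<bar>LINT t|unit_interval. (1 - t) * sin (k \<theta> t)\<bar> \<le> 1"
      by (rule LINT_abs_le_const[OF sinm[OF kc[OF \<theta>]] sinb])
    ultimately show ?thesis unfolding J[OF \<theta>] by linarith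
  qed
  define m where "m = Inf (?J ` \<Theta>)"
  have bdd: "bdd_below (?J ` \<Theta>)" using Jlb by (auto intro!: bdd_belowI[of _ "-1"])
  have "(\<lambda>_. 0) \<in> \<Theta>" by (simp add: \<Theta>_def)
  then have ne: "?J ` \<Theta> \<noteq> {}" by auto
  have mle: "m \<le> ?J \<theta>" if "\<theta> \<in> \<Theta>" for \<theta>
    unfolding m_def using bdd that by (intro cInf_lower) auto
  have "\<exists>\<theta>\<in>\<Theta>. ?J \<theta> < m + 1 / real (Suc n)" for n
    using cInf_lessD[OF ne, of "m + 1 / real (Suc n)"] by (auto simp: m_def)
  then obtain \<theta> where \<theta>: "\<And>n. \<theta> n \<in> \<Theta>" "\<And>n. ?J (\<theta> n) < m + 1 / real (Suc n)" by metis
  \<comment> \<open>Moments are bounded by 1 and stiffnesses are at least a, so all states share the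
    Lipschitz constant 1/a.\<close>
  obtain K and r :: "nat \<Rightarrow> nat" where Kc: "continuous_on {0..1} K" and r: "strict_mono r"
    and unif: "\<And>e. 0 < e \<Longrightarrow> \<exists>N. \<forall>n\<ge>N. \<forall>t\<in>{0..1}. \<bar>k (\<theta> (r n)) t - K t\<bar> < e"
    and lim: "\<And>t. t \<in> {0..1} \<Longrightarrow> (\<lambda>n. k (\<theta> (r n)) t) \<longlonglongrightarrow> K t"
  proof (rule Arzela_Ascoli_lipschitz[of "\<lambda>n. k (\<theta> n)" "pi/2" "1/a"])
    show "\<bar>k (\<theta> n) t\<bar> \<le> pi/2" if "t \<in> {0..1}" for n t using kr[OF \<theta>(1) that, of n] by auto
    show "\<bar>k (\<theta> n) s - k (\<theta> n) t\<bar> \<le> 1/a * \<bar>s - t\<bar>" if "s \<in> {0..1}" "t \<in> {0..1}" for n s t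
    proof -
      let ?h = "\<lambda>s. moment (k (\<theta> n)) s / stiffness a b (\<theta> n) s"
      note mb = moment_bounds[OF kc[OF \<theta>(1)[of n]]]
      have "\<bar>prim ?h s - prim ?h t\<bar> \<le> 1/a * \<bar>s - t\<bar>"
      proof (rule prim_lipschitz)
        show "?h \<in> borel_measurable unit_interval"
          using mb(1) stiffness_measurable[OF \<Theta>m[OF \<theta>(1)[of n]]] by measurable
        show "\<bar>?h s\<bar> \<le> 1/a" if "0 < s" "s < 1" for s
          using mb(2)[OF that] st(1)[OF \<theta>(1)[of n], of s] assms(1) by (auto simp: abs_div intro!: frac_le)
      qed (use that in auto)
      then show ?thesis using keq[OF \<theta>(1) that(1)] keq[OF \<theta>(1) that(2)] by simp
    qed
  qed (use assms in auto)
  have Kr: "- (pi/2) \<le> K t \<and> K t \<le> 0" if t: "t \<in> {0..1}" for t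
    by (intro conjI LIMSEQ_le_const[OF lim[OF t]] LIMSEQ_le_const2[OF lim[OF t]])
       (use kr[OF \<theta>(1) t] in auto)
  note Kb = moment_bounds[OF Kc]
  define S where "S = (LINT t|unit_interval. (1 - t) * sin (K t))"
  have Slim: "(\<lambda>n. LINT t|unit_interval. (1 - t) * sin (k (\<theta> (r n)) t)) \<longlonglongrightarrow> S"
    unfolding S_def
  proof (rule LINT_tendsto_bounded[OF sinm[OF kc[OF \<theta>(1)]] sinm[OF Kc] sinb])
    show "AE t in unit_interval. (\<lambda>n. (1 - t) * sin (k (\<theta> (r n)) t)) \<longlonglongrightarrow> (1 - t) * sin (K t)"
      by (rule AE_I2) (intro tendsto_intros lim, auto)
  qed
  \<comment> \<open>The limit of the volumes: the costs tend to m and the sine integrals to S, so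
    c_l times the volume tends to m + S.\<close>
  define L where "L = (m + S) / c_l"
  have vol: "\<exists>N. \<forall>n\<ge>N. (LINT t|unit_interval. \<theta> (r n) t) \<le> L + e" if e: "0 < e" for e
  proof -
    have "(\<lambda>n. (m + 1 / real (Suc n) + (LINT t|unit_interval. (1 - t) * sin (k (\<theta> (r n)) t))) / c_l) \<longlonglongrightarrow> (m + 0 + S) / c_l"
      by (intro tendsto_intros Slim LIMSEQ_Suc[OF lim_1_over_n]) (use assms in auto)
    from order_tendstoD(2)[OF this, of "L + e"] e
    obtain N where N: "\<And>n. n \<ge> N \<Longrightarrow> (m + 1 / real (Suc n) + (LINT t|unit_interval. (1 - t) * sin (k (\<theta> (r n)) t))) / c_l < L + e"
      by (auto simp: eventually_sequentially L_def)
    have "(LINT t|unit_interval. \<theta> (r n) t) \<le> L + e" if "n \<ge> N" for n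
    proof -
      have "1 / real (Suc (r n)) \<le> 1 / real (Suc n)" using seq_suble[OF r, of n] by (simp add: frac_le)
      with \<theta>(2)[of "r n"] J[OF \<theta>(1), of "r n"]
      have "c_l * (LINT t|unit_interval. \<theta> (r n) t) \<le> m + 1 / real (Suc n) + (LINT t|unit_interval. (1 - t) * sin (k (\<theta> (r n)) t))"
        by linarith
      then have "(LINT t|unit_interval. \<theta> (r n) t) \<le> (m + 1 / real (Suc n) + (LINT t|unit_interval. (1 - t) * sin (k (\<theta> (r n)) t))) / c_l"
        using assms(3) by (simp add: pos_le_divide_eq mult.commute)
      with N[OF that] show ?thesis by linarith
    qed
    then show ?thesis by blast
  qed
  \<comment> \<open>Here f stands for 1/B. For B = a + (b - a) \<theta> the integral of 1/f is a +
    (b - a) int \<theta>, whence the volume bound. The moment is that of the fixed limit K and not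
    of the state belonging to f; this is what makes the last condition affine.\<close>
  define C where "C = (\<lambda>e. {f \<in> borel_measurable unit_interval. (\<forall>t. 1 / b \<le> f t \<and> f t \<le> 1 / a) \<and>
    (LINT t|unit_interval. 1 / f t) \<le> a + (b - a) * (L + e) \<and>
    (\<forall>t\<in>{0..1}. \<bar>prim (\<lambda>s. moment K s * f s) t + K t\<bar> \<le> e)})"
  have Cpos: "0 < f t" if "f \<in> C e" for f e t
  proof -
    have "1 / b \<le> f t" using that by (simp add: C_def)
    moreover have "0 < 1 / b" using b by simp
    ultimately show ?thesis by linarith
  qed
  have Cb: "\<bar>f t\<bar> \<le> 1 / a" if "f \<in> C e" for f e t
    using Cpos[OF that, of t] that by (auto simp: C_def)
  have Cinv: "\<bar>1 / f t\<bar> \<le> b" if "f \<in> C e" for f e t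
  proof -
    have "1 / b \<le> f t" using that by (simp add: C_def)
    then show ?thesis using Cpos[OF that, of t] b by (simp add: field_simps)
  qed
  have Cm: "f \<in> borel_measurable unit_interval" if "f \<in> C e" for f e using that by (simp add: C_def)
  have Ci: "integrable unit_interval (\<lambda>t. 1 / f t)" if "f \<in> C e" for f e
    by (rule integrable_unit_interval_bounded[where C = b]) (use Cm[OF that] Cinv[OF that] in auto)
  have if1: "integrable unit_interval f" if "f \<in> C e" for f e
    by (rule integrable_unit_interval_bounded[OF Cm[OF that] Cb[OF that]])
  have Cprod: "integrable unit_interval (\<lambda>s. moment K s * f s)" if "f \<in> C e" for f e
    by (rule integrable_mult_bounded[OF if1[OF that] Kb])
  have Cne: "C e \<noteq> {}" if e: "0 < e" for e
  proof -
    \<comment> \<open>A uniform distance d between the states costs d from the values themselves and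
      d/a from the moments under the integral, together e.\<close>
    define d where "d = e / (1 + 1 / a)"
    have d: "0 < d" "d * (1 + 1 / a) = e"
    proof -
      have "0 < 1 + 1 / a" using assms(1) by (simp add: add_pos_pos)
      then show "0 < d" "d * (1 + 1 / a) = e" using e by (auto simp: d_def)
    qed
    obtain N1 where N1: "\<And>n t. n \<ge> N1 \<Longrightarrow> t \<in> {0..1} \<Longrightarrow> \<bar>k (\<theta> (r n)) t - K t\<bar> < d" using unif[OF d(1)] by blast
    obtain N2 where N2: "\<And>n. n \<ge> N2 \<Longrightarrow> (LINT t|unit_interval. \<theta> (r n) t) \<le> L + e" using vol[OF e] by blast
    define n where "n = max N1 N2"
    let ?\<theta> = "\<theta> (r n)" and ?B = "stiffness a b (\<theta> (r n))"
    let ?k = "k ?\<theta>"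
    let ?f = "\<lambda>t. 1 / ?B t"
    have T: "?\<theta> \<in> \<Theta>" by (rule \<theta>(1))
    have Bm[measurable]: "?B \<in> borel_measurable unit_interval" by (rule stiffness_measurable[OF \<Theta>m[OF T]])
    have Bp: "0 < ?B t" for t using st(1)[OF T, of t] assms(1) by linarith
    have fb: "1 / b \<le> ?f t" "?f t \<le> 1 / a" for t
      using st[OF T, of t] Bp[of t] assms(1) by (auto intro!: divide_left_mono)
    have "(LINT t|unit_interval. 1 / ?f t) = (LINT t|unit_interval. a + (b - a) * ?\<theta> t)"
      by (simp add: stiffness_alt)
    also have "\<dots> = a + (b - a) * (LINT t|unit_interval. ?\<theta> t)"
      using \<Theta>i[OF T] by (simp add: measure_unit_interval)
    also have "\<dots> \<le> a + (b - a) * (L + e)"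
      using N2[of n] assms(2) by (intro add_left_mono mult_left_mono) (auto simp: n_def)
    finally have v: "(LINT t|unit_interval. 1 / ?f t) \<le> a + (b - a) * (L + e)" .
    have "\<bar>prim (\<lambda>s. moment K s * ?f s) t + K t\<bar> \<le> e" if t: "t \<in> {0..1}" for t
    proof -
      have fi: "integrable unit_interval ?f"
        by (rule integrable_unit_interval_bounded[where C = "1 / a"]) (use fb(2) Bp in \<open>auto simp: less_imp_le\<close>)
      have i: "integrable unit_interval (\<lambda>s. moment l s * ?f s)" if "continuous_on {0..1} l" for l
        by (rule integrable_mult_bounded[OF fi moment_bounds[OF that]])
      note i = i[OF Kc] i[OF kc[OF T]]
      let ?h = "\<lambda>s. moment K s * ?f s - moment ?k s * ?f s"
      have split: "prim (\<lambda>s. moment K s * ?f s) t + K t = prim ?h t + (K t - ?k t)"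
        using keq[OF T t] prim_diff[OF i, of t] by simp
      have near: "\<bar>K t - ?k t\<bar> \<le> d" using N1[of n t] t by (simp add: n_def abs_minus_commute)
      have "\<bar>prim ?h t\<bar> \<le> d * (1 / a)"
        unfolding prim_def
      proof (rule LINT_abs_le_const)
        show "(\<lambda>s. indicator {..t} s * ?h s) \<in> borel_measurable unit_interval"
          using Kb(1) moment_bounds(1)[OF kc[OF T]] by measurable
        fix s :: real assume s: "0 < s" "s < 1"
        have "\<bar>?h s\<bar> = \<bar>moment K s - moment ?k s\<bar> * ?f s"
          using Bp[of s] by (simp add: abs_mult[symmetric] diff_divide_distrib[symmetric] abs_div)
        also have "\<dots> \<le> d * (1 / a)"
        proof (rule mult_mono)
          show "\<bar>moment K s - moment ?k s\<bar> \<le> d"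
            by (rule moment_diff_le[OF Kc kc[OF T]])
               (use N1[of n] s in \<open>auto simp: n_def abs_minus_commute intro!: less_imp_le\<close>)
        qed (use fb(2) Bp d in \<open>auto simp: less_imp_le\<close>)
        finally have "\<bar>?h s\<bar> \<le> d * (1 / a)" .
        moreover have "0 \<le> d * (1 / a)" using d(1) assms(1) by simp
        ultimately show "\<bar>indicator {..t} s * ?h s\<bar> \<le> d * (1 / a)" by (auto simp: indicator_def)
      qed
      moreover have "d * (1 / a) + d = e" using d(2) by (simp add: algebra_simps)
      ultimately show ?thesis unfolding split using near by linarith
    qed
    then have "?f \<in> C e" using fb v by (auto simp: C_def)
    then show ?thesis by blast
  qed
  have Cmono: "C d \<subseteq> C e" if "d \<le> e" for d e
  proof -
    have "(b - a) * (L + d) \<le> (b - a) * (L + e)" using that assms(2) by (intro mult_left_mono) auto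
    then show ?thesis using that by (force simp: C_def)
  qed
  have Cmid: "(\<lambda>t. (f t + g t) / 2) \<in> C e" if f: "f \<in> C e" and g: "g \<in> C e" for f g e
  proof -
    let ?h = "\<lambda>t. (f t + g t) / 2"
    have hm: "?h \<in> borel_measurable unit_interval" using Cm[OF f] Cm[OF g] by measurable
    have hb: "1 / b \<le> ?h t" "?h t \<le> 1 / a" for t
    proof -
      have "1 / b \<le> f t" "f t \<le> 1 / a" "1 / b \<le> g t" "g t \<le> 1 / a" using f g by (auto simp: C_def)
      moreover have "x \<le> (u + v) / 2" if "x \<le> u" "x \<le> v" for x u v :: real using that by simp
      moreover have "(u + v) / 2 \<le> x" if "u \<le> x" "v \<le> x" for x u v :: real using that by simp
      ultimately show "1 / b \<le> ?h t" "?h t \<le> 1 / a" by blast+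
    qed
    have ile: "1 / ?h t \<le> (1 / f t + 1 / g t) / 2" for t
      by (rule inverse_midpoint_le) (use Cpos f g in auto)
    have "(LINT t|unit_interval. 1 / ?h t) \<le> (LINT t|unit_interval. (1 / f t + 1 / g t) / 2)"
    proof (rule integral_mono)
      show i: "integrable unit_interval (\<lambda>t. (1 / f t + 1 / g t) / 2)" using Ci[OF f] Ci[OF g] by simp
      show "integrable unit_interval (\<lambda>t. 1 / ?h t)"
      proof (rule Bochner_Integration.integrable_bound[OF i])
        show "(\<lambda>t. 1 / ?h t) \<in> borel_measurable unit_interval" using hm by measurable
        show "AE t in unit_interval. norm (1 / ?h t) \<le> norm ((1 / f t + 1 / g t) / 2)"
        proof (rule AE_I2)
          fix t
          have "0 < 1 / ?h t" using Cpos[OF f, of t] Cpos[OF g, of t] by simp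
          with ile[of t] show "norm (1 / ?h t) \<le> norm ((1 / f t + 1 / g t) / 2)"
            unfolding real_norm_def by linarith
        qed
      qed
    qed (rule ile)
    also have "\<dots> = ((LINT t|unit_interval. 1 / f t) + (LINT t|unit_interval. 1 / g t)) / 2"
      using Ci[OF f] Ci[OF g] by simp
    also have "\<dots> \<le> a + (b - a) * (L + e)" using f g by (simp add: C_def)
    finally have v: "(LINT t|unit_interval. 1 / ?h t) \<le> a + (b - a) * (L + e)" .
    have "\<bar>prim (\<lambda>s. moment K s * ?h s) t + K t\<bar> \<le> e" if t: "t \<in> {0..1}" for t
    proof -
      have "prim (\<lambda>s. moment K s * ?h s) t = prim (\<lambda>s. 1/2 * (moment K s * f s + moment K s * g s)) t"
        by (simp add: algebra_simps add_divide_distrib)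
      also have "\<dots> = 1/2 * (prim (\<lambda>s. moment K s * f s) t + prim (\<lambda>s. moment K s * g s) t)"
        using prim_add[OF Cprod[OF f] Cprod[OF g], of t] by (simp only: prim_cmult)
      finally have eq: "prim (\<lambda>s. moment K s * ?h s) t + K t =
        ((prim (\<lambda>s. moment K s * f s) t + K t) + (prim (\<lambda>s. moment K s * g s) t + K t)) / 2" by simp
      have "\<bar>prim (\<lambda>s. moment K s * f s) t + K t\<bar> \<le> e" "\<bar>prim (\<lambda>s. moment K s * g s) t + K t\<bar> \<le> e"
        using f g t by (auto simp: C_def)
      moreover have "\<bar>(u + v) / 2\<bar> \<le> e" if "\<bar>u\<bar> \<le> e" "\<bar>v\<bar> \<le> e" for u v :: real
        using that unfolding abs_le_iff by (auto simp: field_simps)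
      ultimately show ?thesis unfolding eq by blast
    qed
    then show ?thesis using hm hb v by (auto simp: C_def)
  qed
  obtain f g where f: "\<And>n. f n \<in> C (1 / real (Suc n))" and gm: "g \<in> borel_measurable unit_interval"
    and fg: "AE t in unit_interval. (\<lambda>n. f n t) \<longlonglongrightarrow> g t"
  proof (rule nested_convex_AE_convergent[of "\<lambda>n. C (1 / real (Suc n))" "1 / a"])
    show "decseq (\<lambda>n. C (1 / real (Suc n)))"
      by (intro decseq_SucI Cmono) (simp add: frac_le)
  qed (use Cne Cmid Cm Cb in auto)
  \<comment> \<open>The limit g obeys the bounds only a.e. Clamping makes them hold everywhere and
    leaves each \<open>f n\<close>, which already lies between them, unchanged.\<close>
  define \<sigma> where "\<sigma> = (\<lambda>t. max (1 / b) (min (1 / a) (g t)))"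
  have \<sigma>m[measurable]: "\<sigma> \<in> borel_measurable unit_interval" unfolding \<sigma>_def using gm by measurable
  have ba: "1 / b \<le> 1 / a" using assms by (simp add: frac_le)
  have \<sigma>b: "1 / b \<le> \<sigma> t" "\<sigma> t \<le> 1 / a" for t unfolding \<sigma>_def using ba by auto
  have \<sigma>p: "0 < \<sigma> t" for t
  proof -
    have "0 < 1 / b" using b by simp
    with \<sigma>b(1)[of t] show ?thesis by linarith
  qed
  have f\<sigma>: "AE t in unit_interval. (\<lambda>n. f n t) \<longlonglongrightarrow> \<sigma> t"
    using fg
  proof eventually_elim
    fix t assume "(\<lambda>n. f n t) \<longlonglongrightarrow> g t"
    then have "(\<lambda>n. max (1 / b) (min (1 / a) (f n t))) \<longlonglongrightarrow> \<sigma> t"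
      unfolding \<sigma>_def by (intro tendsto_intros)
    moreover have "max (1 / b) (min (1 / a) (f n t)) = f n t" for n
      using f[of n] by (auto simp: C_def max_def min_def antisym)
    ultimately show "(\<lambda>n. f n t) \<longlonglongrightarrow> \<sigma> t" by simp
  qed
  have tend: "(\<lambda>n. 1 / real (Suc n)) \<longlonglongrightarrow> 0" by (rule LIMSEQ_Suc[OF lim_1_over_n])
  have "(\<lambda>n. LINT t|unit_interval. 1 / f n t) \<longlonglongrightarrow> (LINT t|unit_interval. 1 / \<sigma> t)"
  proof (rule LINT_tendsto_bounded[where C = b])
    show "(\<lambda>t. 1 / f n t) \<in> borel_measurable unit_interval" for n using Cm[OF f, of n] by measurable
    show "AE t in unit_interval. (\<lambda>n. 1 / f n t) \<longlonglongrightarrow> 1 / \<sigma> t"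
      using f\<sigma> by eventually_elim (use \<sigma>p in \<open>auto intro!: tendsto_intros simp: less_imp_neq[THEN not_sym]\<close>)
  qed (use Cinv[OF f] in auto)
  moreover have "(\<lambda>n. a + (b - a) * (L + 1 / real (Suc n))) \<longlonglongrightarrow> a + (b - a) * (L + 0)"
    by (intro tendsto_intros tend)
  moreover have "(LINT t|unit_interval. 1 / f n t) \<le> a + (b - a) * (L + 1 / real (Suc n))" for n
    using f[of n] by (simp add: C_def)
  ultimately have \<sigma>vol: "(LINT t|unit_interval. 1 / \<sigma> t) \<le> a + (b - a) * L"
    by (intro LIMSEQ_le[of _ "LINT t|unit_interval. 1 / \<sigma> t" _ "a + (b - a) * L"]) auto
  have Keq: "K t = - prim (\<lambda>s. moment K s * \<sigma> s) t" if t: "t \<in> {0..1}" for t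
  proof -
    have "(\<lambda>n. prim (\<lambda>s. moment K s * f n s) t) \<longlonglongrightarrow> prim (\<lambda>s. moment K s * \<sigma> s) t"
    proof (rule prim_tendsto_bounded[where C = "1 * (1 / a)"])
      show "(\<lambda>s. moment K s * f n s) \<in> borel_measurable unit_interval" for n
        using Kb(1) Cm[OF f, of n] by measurable
      show "(\<lambda>s. moment K s * \<sigma> s) \<in> borel_measurable unit_interval" using Kb(1) by measurable
      show "\<bar>moment K s * f n s\<bar> \<le> 1 * (1 / a)" if "0 < s" "s < 1" for n s
        unfolding abs_mult using Kb(2)[OF that] Cb[OF f, of n s] by (intro mult_mono) auto
      show "AE s in unit_interval. (\<lambda>n. moment K s * f n s) \<longlonglongrightarrow> moment K s * \<sigma> s"
        using f\<sigma> by eventually_elim (rule tendsto_mult_left)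
    qed
    then have "(\<lambda>n. \<bar>prim (\<lambda>s. moment K s * f n s) t + K t\<bar>) \<longlonglongrightarrow> \<bar>prim (\<lambda>s. moment K s * \<sigma> s) t + K t\<bar>"
      by (intro tendsto_intros)
    moreover have "\<bar>prim (\<lambda>s. moment K s * f n s) t + K t\<bar> \<le> 1 / real (Suc n)" for n
      using f[of n] t by (simp add: C_def)
    ultimately have "\<bar>prim (\<lambda>s. moment K s * \<sigma> s) t + K t\<bar> \<le> 0"
      using tend by (intro LIMSEQ_le) auto
    then show ?thesis by linarith
  qed
  \<comment> \<open>Solves a + (b - a) \<theta>' = 1/\<sigma>.\<close>
  define \<theta>' where "\<theta>' = (\<lambda>t. (1 / \<sigma> t - a) / (b - a))"
  have st': "stiffness a b \<theta>' = (\<lambda>t. 1 / \<sigma> t)"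
    using assms by (auto simp: fun_eq_iff stiffness_alt \<theta>'_def)
  have inv\<sigma>: "a \<le> 1 / \<sigma> t" "1 / \<sigma> t \<le> b" for t
    using \<sigma>b[of t] \<sigma>p[of t] assms(1) b by (auto simp: field_simps)
  have \<theta>'\<Theta>: "\<theta>' \<in> \<Theta>"
    unfolding \<Theta>_def \<theta>'_def using inv\<sigma> assms by (auto simp: divide_le_eq)
  have "state (stiffness a b \<theta>') = restrict K {0..1}"
  proof (rule state_eqI[OF stiffness_measurable[OF \<Theta>m[OF \<theta>'\<Theta>]] st[OF \<theta>'\<Theta>] assms(1) Kc _ Kr])
    show "K t = - prim (\<lambda>s. moment K s / stiffness a b \<theta>' s) t" if "t \<in> {0..1}" for t
      using Keq[OF that] by (simp add: st')
  qed auto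
  \<comment> \<open>The state is K itself, so the sine part of the cost is exactly S. A volume of at
    most L then gives the bound -S + c_l L, which is m by the choice of L.\<close>
  then have "?J \<theta>' = - S + c_l * (LINT t|unit_interval. \<theta>' t)"
    unfolding S_def by (rule reduced_cost_eq)
  also have "\<dots> \<le> - S + c_l * L"
  proof -
    have "integrable unit_interval (\<lambda>t. 1 / \<sigma> t)"
      by (rule integrable_unit_interval_bounded[where C = b]) (use inv\<sigma> \<sigma>p in \<open>auto simp: less_imp_le\<close>)
    then have "(LINT t|unit_interval. \<theta>' t) = ((LINT t|unit_interval. 1 / \<sigma> t) - a) / (b - a)"
      unfolding \<theta>'_def by (simp add: measure_unit_interval)
    also have "\<dots> \<le> L" using \<sigma>vol assms(2) by (simp add: pos_divide_le_eq mult.commute)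
    finally show ?thesis using assms(3) by simp
  qed
  also have "\<dots> = m" using assms(3) by (simp add: L_def)
  finally have best: "?J \<theta>' \<le> m" .
  show ?thesis
  proof (intro bexI ballI)
    show "\<theta>' \<in> Linf_into {0..1}" using \<theta>'\<Theta> by (auto simp: \<Theta>_def Linf_into_def)
    fix \<eta> :: "real \<Rightarrow> real" assume "\<eta> \<in> Linf_into {0..1}"
    then have \<eta>m: "\<eta> \<in> borel_measurable unit_interval" and \<eta>: "AE t in unit_interval. \<eta> t \<in> {0..1}"
      by (auto simp: Linf_into_def)
    let ?c = "\<lambda>t. max 0 (min 1 (\<eta> t))"
    have cm: "?c \<in> borel_measurable unit_interval" using \<eta>m by measurable
    have "AE t in unit_interval. \<eta> t = ?c t" using \<eta> by eventually_elim auto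
    then have "?J \<eta> = ?J ?c" by (rule reduced_cost_cong_AE[OF _ \<eta>m cm])
    moreover have "?c \<in> \<Theta>" using cm by (auto simp: \<Theta>_def)
    ultimately show "?J \<theta>' \<le> ?J \<eta>" using best mle by fastforce
  qed
qed

end
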